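(* Let $p$ be an odd prime and $D$ a discriminant form of type $p^{\epsilon n}$. Then \[\dim\mathbb C[D]^{\Gamma}=\frac{p^{n-1}-p}{p^2-1}+\epsilon\left(\frac{-1}{p}\right)^{n/2}p^{(n-2)/2}+1\] if $n$ is even, and \[\dim\mathbb C[D]^{\Gamma}=\frac{p^{n-1}-1}{p^2-1}\] if $n$ is odd.
   Context: A discriminant form is a finite abelian group $D$ with a quadratic form $\operatorname{q}:D\to\mathbb Q/\mathbb Z$ whose associated bilinear form $(\beta,\gamma)=\operatorname{q}(\beta+\gamma)-\operatorname{q}(\beta)-\operatorname{q}(\gamma)$ is nondegenerate. For odd $p$, $p^{\epsilon n}$ is the orthogonal sum of $n$ cyclic forms of order $p$, each generated by $\gamma$ with $\operatorname{q}(\gamma)=a/p$, $p\nmid a$, with $\epsilon=\pm1$ the product of the Legendre symbols $(\frac{2a}{p})$; such forms have even signature $\operatorname{sign}(D)\in\mathbb Z/8\mathbb Z$. $e(x)=e^{2\pi ix}$, $\Gamma=\operatorname{SL}_2(\mathbb Z)$. $\mathbb C[D]^\Gamma$ denotes the invariants of the Weil representation $\rho_D$ on $\mathbb C[D]$ given by $\rho_D(T)e^\gamma=e(-\operatorname{q}(\gamma))e^\gamma$, $\rho_D(S)e^\gamma=\frac{e(\operatorname{sign}(D)/8)}{\sqrt{|D|}}\sum_\beta e((\gamma,\beta))e^\beta$. *)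

theory Defs
  imports "HOL-Analysis.Analysis" "HOL-Number_Theory.Residues"
begin

section \<open>The group \<open>\<rat>/\<int>\<close>\<close>

quotient_type rat_mod_int = rat / "\<lambda>x y :: rat. x - y \<in> \<int>"
  morphisms rep_rat_mod_int rat_class
proof (rule equivpI)
  show "reflp (\<lambda>x y :: rat. x - y \<in> \<int>)"
    by (simp add: reflp_def)
  show "symp (\<lambda>x y :: rat. x - y \<in> \<int>)"
    by (rule sympI) (metis Ints_minus minus_diff_eq)
  show "transp (\<lambda>x y :: rat. x - y \<in> \<int>)"
  proof (rule transpI)
    fix x y z :: rat
    assume "x - y \<in> \<int>" "y - z \<in> \<int>"
    then have "(x - y) + (y - z) \<in> \<int>" by (rule Ints_add)
    then show "x - z \<in> \<int>" by simp
  qed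
qed

instantiation rat_mod_int :: ab_group_add
begin

lift_definition zero_rat_mod_int :: rat_mod_int is "0 :: rat" .

lift_definition plus_rat_mod_int :: "rat_mod_int \<Rightarrow> rat_mod_int \<Rightarrow> rat_mod_int"
  is "(+) :: rat \<Rightarrow> rat \<Rightarrow> rat"
proof -
  fix a b c d :: rat
  assume "a - b \<in> \<int>" "c - d \<in> \<int>"
  then have "(a - b) + (c - d) \<in> \<int>" by (rule Ints_add)
  then show "a + c - (b + d) \<in> \<int>" by (simp add: algebra_simps)
qed

lift_definition uminus_rat_mod_int :: "rat_mod_int \<Rightarrow> rat_mod_int"
  is "uminus :: rat \<Rightarrow> rat"
proof -
  fix a b :: rat
  assume "a - b \<in> \<int>"
  then have "- (a - b) \<in> \<int>" by (rule Ints_minus)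
  then show "- a - - b \<in> \<int>" by simp
qed

lift_definition minus_rat_mod_int :: "rat_mod_int \<Rightarrow> rat_mod_int \<Rightarrow> rat_mod_int"
  is "(-) :: rat \<Rightarrow> rat \<Rightarrow> rat"
proof -
  fix a b c d :: rat
  assume "a - b \<in> \<int>" "c - d \<in> \<int>"
  then have "(a - b) - (c - d) \<in> \<int>" by (rule Ints_diff)
  then show "a - c - (b - d) \<in> \<int>" by (simp add: algebra_simps)
qed

instance
  by standard (transfer, simp add: algebra_simps)+

end

lift_definition e :: "rat_mod_int \<Rightarrow> complex"
  is "\<lambda>x. exp (2 * of_real pi * \<i> * of_rat x)"
proof -
  fix x y :: rat
  assume "x - y \<in> \<int>"
  then obtain k where "x - y = of_int k" by (elim Ints_cases)
  then have x: "x = y + of_int k" by simp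
  have "exp (2 * of_real pi * \<i> * of_rat x)
      = exp (2 * of_real pi * \<i> * of_rat y) * exp (2 * of_int k * of_real pi * \<i>)"
    by (subst exp_add[symmetric]) (simp add: x of_rat_add algebra_simps)
  also have "exp (2 * of_int k * of_real pi * \<i>) = (1 :: complex)"
    using exp_integer_2pi[of "of_int k"] by simp
  finally show "exp (2 * of_real pi * \<i> * of_rat x) = exp (2 * of_real pi * \<i> * of_rat y :: complex)"
    by simp
qed

section \<open>Discriminant forms\<close>

definition zmult :: "int \<Rightarrow> 'a::ab_group_add \<Rightarrow> 'a" where
  "zmult k x = (if k \<ge> 0 then \<Sum>_<nat k. x else - (\<Sum>_<nat (- k). x))"

definition bilin :: "('d::ab_group_add \<Rightarrow> rat_mod_int) \<Rightarrow> 'd \<Rightarrow> 'd \<Rightarrow> rat_mod_int" where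
  "bilin q \<beta> \<gamma> = q (\<beta> + \<gamma>) - q \<beta> - q \<gamma>"

definition quadratic_form :: "('d::ab_group_add \<Rightarrow> rat_mod_int) \<Rightarrow> bool" where
  "quadratic_form q \<longleftrightarrow>
     (\<forall>k \<gamma>. q (zmult k \<gamma>) = zmult (k\<^sup>2) (q \<gamma>)) \<and>
     (\<forall>\<alpha> \<beta> \<gamma>. bilin q (\<alpha> + \<beta>) \<gamma> = bilin q \<alpha> \<gamma> + bilin q \<beta> \<gamma>) \<and>
     (\<forall>\<alpha> \<beta> \<gamma>. bilin q \<alpha> (\<beta> + \<gamma>) = bilin q \<alpha> \<beta> + bilin q \<alpha> \<gamma>)"

definition discriminant_form :: "('d::{finite,ab_group_add} \<Rightarrow> rat_mod_int) \<Rightarrow> bool" where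
  "discriminant_form q \<longleftrightarrow>
     quadratic_form q \<and> (\<forall>\<beta>. (\<forall>\<gamma>. bilin q \<beta> \<gamma> = 0) \<longrightarrow> \<beta> = 0)"

text \<open>The signature in \<open>\<int>/8\<int>\<close>, represented in \<open>{0,\<dots>,7}\<close>, normalised by Milgram's
  formula \<open>\<Sum>\<^sub>\<gamma> e(q(\<gamma>)) = \<surd>|D| e(sign(D)/8)\<close>.\<close>

definition signature :: "('d::{finite,ab_group_add} \<Rightarrow> rat_mod_int) \<Rightarrow> int" where
  "signature q = (THE s. s \<in> {0..<8} \<and>
     (\<Sum>\<gamma>\<in>UNIV. e (q \<gamma>)) = of_real (sqrt (real CARD('d))) * e (rat_class (of_int s / 8)))"

definition cyclic_span :: "'a::ab_group_add \<Rightarrow> 'a set" where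
  "cyclic_span \<gamma> = range (\<lambda>k. zmult k \<gamma>)"

text \<open>Type \<open>p\<^bsup>\<epsilon>n\<^esup>\<close>: the group is the internal orthogonal direct sum of cyclic subgroups of
  order \<open>p\<close> generated by \<open>g 0, \<dots>, g (n - 1)\<close>.\<close>

definition has_type :: "('d::{finite,ab_group_add} \<Rightarrow> rat_mod_int) \<Rightarrow> nat \<Rightarrow> int \<Rightarrow> nat \<Rightarrow> bool" where
  "has_type q p \<epsilon> n \<longleftrightarrow>
     (\<exists>(g :: nat \<Rightarrow> 'd) (a :: nat \<Rightarrow> int).
        (\<forall>i<n. card (cyclic_span (g i)) = p \<and> \<not> int p dvd a i \<and>
               q (g i) = rat_class (of_int (a i) / of_nat p)) \<and>
        (\<forall>i<n. \<forall>j<n. i \<noteq> j \<longrightarrow>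
               (\<forall>x\<in>cyclic_span (g i). \<forall>y\<in>cyclic_span (g j). bilin q x y = 0)) \<and>
        bij_betw (\<lambda>x. \<Sum>i<n. x i) (\<Pi>\<^sub>E i\<in>{..<n}. cyclic_span (g i)) UNIV \<and>
        \<epsilon> = (\<Prod>i<n. Legendre (2 * a i) (int p)))"

section \<open>The Weil representation\<close>

definition SL2Z :: "(int^2^2) set" where
  "SL2Z = {M. det M = 1}"

definition matS :: "int^2^2" where
  "matS = vector [vector [0, -1], vector [1, 0]]"

definition matT :: "int^2^2" where
  "matT = vector [vector [1, 1], vector [0, 1]]"

text \<open>The group algebra \<open>\<complex>[D]\<close> is \<open>complex^'d\<close>, with \<open>e\<^sup>\<gamma> = axis \<gamma> 1\<close>. Since \<open>S\<close> and \<open>T\<close> generate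
  \<open>SL\<^sub>2(\<int>)\<close>, the conditions determine \<open>\<rho>\<close> on \<open>SL2Z\<close>; its values elsewhere are irrelevant.\<close>

definition weil_representation ::
  "('d::{finite,ab_group_add} \<Rightarrow> rat_mod_int) \<Rightarrow> (int^2^2 \<Rightarrow> (complex, 'd) vec \<Rightarrow> (complex, 'd) vec) \<Rightarrow> bool" where
  "weil_representation q \<rho> \<longleftrightarrow>
     (\<forall>M\<in>SL2Z. Vector_Spaces.linear (*s) (*s) (\<rho> M)) \<and>
     \<rho> (mat 1) = id \<and>
     (\<forall>M\<in>SL2Z. \<forall>N\<in>SL2Z. \<rho> (M ** N) = \<rho> M \<circ> \<rho> N) \<and>
     (\<forall>\<gamma>. \<rho> matT (axis \<gamma> 1) = e (- q \<gamma>) *s axis \<gamma> 1) \<and>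
     (\<forall>\<gamma>. \<rho> matS (axis \<gamma> 1) =
        (e (rat_class (of_int (signature q) / 8)) / of_real (sqrt (real CARD('d)))) *s
        (\<Sum>\<beta>\<in>UNIV. e (bilin q \<gamma> \<beta>) *s axis \<beta> 1))"

definition invariants :: "(int^2^2 \<Rightarrow> complex^'d \<Rightarrow> complex^'d) \<Rightarrow> (complex^'d) set" where
  "invariants \<rho> = {v. \<forall>M\<in>SL2Z. \<rho> M v = v}"

end

theory Submission
  imports Defs "HOL-Number_Theory.Euler_Criterion"
begin

text \<open>
  Write \<open>X\<close> for the set of isotropic elements and \<open>\<eta>(s) = (s/p)\<^sup>n\<close>. Since \<open>S\<close> and \<open>T\<close> generate the
  modular group, the invariants are the functions supported on \<open>X\<close> that are fixed by the
  finite Fourier transform \<open>F\<close> representing \<open>S\<close>. Let \<open>K\<close> be the compression of \<open>F\<close> to functions on \<open>X\<close>.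
  Expanding the indicator function of \<open>X\<close> in additive characters and completing the square
  gives \<open>p K\<^sup>2 f(\<beta>) = \<eta>(-1) f(-\<beta>) + (\<Sum>s. \<eta>(s) (K f)(s\<beta>))\<close>. Hence a fixed function is equivariant,
  \<open>f(s\<beta>) = \<eta>(s) f(\<beta>)\<close>, and on equivariant functions \<open>p K\<^sup>2 = 1 + (p - 1) K\<close>, so that \<open>(p K + 1) / (p + 1)\<close>
  is the projection onto the fixed functions (the Hecke algebra of a Borel subgroup of \<open>SL\<^sub>2(F\<^sub>p)\<close>
  in disguise). The dimension is the trace of that projection, which only involves \<open>|X|\<close>
  and Gauss sums; the sign of the quadratic Gauss sum is never needed.
\<close>

subsection \<open>Multiples and additive characters\<close>

lemma zmult_0 [simp]: "zmult 0 x = 0"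
  by (simp add: zmult_def)

lemma zmult_add_one: "zmult (k + 1) x = zmult k x + x"
proof (cases "k \<ge> 0")
  case True
  then have "nat (k + 1) = Suc (nat k)" by simp
  with True show ?thesis by (simp add: zmult_def)
next
  case False
  then have "nat (- k) = Suc (nat (- (k + 1)))" by simp
  with False show ?thesis by (auto simp: zmult_def)
qed

lemma zmult_diff_one: "zmult (k - 1) x = zmult k x - x"
  using zmult_add_one[of "k - 1" x] by simp

lemma zmult_1 [simp]: "zmult 1 x = x"
  using zmult_add_one[of 0 x] by simp

lemma zmult_add: "zmult (k + l) x = zmult k x + zmult l x"
proof (induction l rule: int_induct[where k = 0])
  case (step1 i)
  then show ?case using zmult_add_one[of "k + i" x] zmult_add_one[of i x]
    by (simp add: add.assoc)
next
  case (step2 i)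
  then show ?case using zmult_diff_one[of "k + i" x] zmult_diff_one[of i x]
    by (simp add: add_diff_eq)
qed simp

lemma additive_zmult:
  assumes "\<And>x y. f (x + y) = f x + f y"
  shows "f (zmult k x) = zmult k (f x)"
proof (induction k rule: int_induct[where k = 0])
  case base
  show ?case using assms[of 0 0] by simp
next
  case (step1 i)
  then show ?case by (simp add: zmult_add_one assms)
next
  case (step2 i)
  have "f (zmult (i - 1) x + x) = f (zmult (i - 1) x) + f x" by (rule assms)
  then show ?case using step2 by (simp add: zmult_diff_one algebra_simps)
qed

lemma zmult_mult: "zmult (k * l) x = zmult k (zmult l x)"
proof (induction k rule: int_induct[where k = 0])
  case (step1 i)
  then show ?case by (simp add: zmult_add_one zmult_add distrib_right)
next
  case (step2 i)
  then show ?case using zmult_add[of "(i - 1) * l" l x]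
    by (simp add: zmult_diff_one algebra_simps)
qed simp

lemma zmult_minus: "zmult (- k) x = - zmult k x"
  using zmult_add[of "- k" k x] by (simp add: eq_neg_iff_add_eq_0)

lemma zmult_diff: "zmult (k - l) x = zmult k x - zmult l x"
  using zmult_add[of k "- l" x] by (simp add: zmult_minus)

lemma zmult_add_right: "zmult k (x + y) = zmult k x + zmult k y"
  by (induction k rule: int_induct[where k = 0])
     (simp_all add: zmult_add_one zmult_diff_one algebra_simps)

lemma zmult_minus_right: "zmult k (- x) = - zmult k x"
  using zmult_mult[of k "-1" x] zmult_mult[of "-1" k x]
  by (simp add: zmult_minus)

lemma zmult_zero_right [simp]: "zmult k 0 = 0"
  using zmult_add_right[of k 0 0] by simp

lemma zmult_cong:
  assumes "zmult (int p) x = 0" "[k = l] (mod int p)"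
  shows "zmult k x = zmult l x"
proof -
  obtain m where "k = l + m * int p"
    using assms(2) by (metis cong_iff_lin cong_sym mult.commute)
  then show ?thesis using assms(1) by (simp add: zmult_add zmult_mult)
qed

lemma zmult_mod: "zmult (int p) x = 0 \<Longrightarrow> zmult (k mod int p) x = zmult k x"
  by (rule zmult_cong[of p]) simp_all

lemma zmult_rat_class: "zmult k (rat_class r) = rat_class (of_int k * r)"
proof -
  have plus: "rat_class (x + y) = rat_class x + rat_class y" for x y
    by (simp add: plus_rat_mod_int.abs_eq)
  have "zmult k r = of_int k * r"
    by (induction k rule: int_induct[where k = 0])
       (simp_all add: zmult_add_one zmult_diff_one algebra_simps)
  then show ?thesis
    using additive_zmult[of rat_class k r] plus by simp
qed

section \<open>The character \<open>e\<close> of the rationals modulo 1\<close>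

lemma e_add: "e (x + y) = e x * e y"
  by transfer (simp add: of_rat_add distrib_left exp_add)

lemma e_0 [simp]: "e 0 = 1"
  by transfer simp

lemma e_minus: "e (- x) = inverse (e x)"
  using e_add[of "- x" x] by (metis add.left_inverse e_0 inverse_unique mult.commute)

lemma complex_of_rat_eq: "complex_of_rat x = of_real (of_rat x)"
  by (cases x) (simp add: of_rat_rat)

lemma norm_e [simp]: "norm (e x) = 1"
proof (transfer)
  fix x :: rat
  have "exp (2 * of_real pi * \<i> * of_rat x) = cis (2 * pi * of_rat x)"
    by (simp add: cis_conv_exp mult_ac complex_of_rat_eq)
  then show "norm (exp (2 * of_real pi * \<i> * of_rat x)) = 1" by simp
qed

lemma e_nonzero [simp]: "e x \<noteq> 0"
  using norm_e[of x] by (metis norm_zero zero_neq_one)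

lemma cnj_e: "cnj (e x) = e (- x)"
  by (simp add: e_minus divide_conv_cnj inverse_eq_divide)

text \<open>Faithfulness of \<open>e\<close> is what lets character sums detect zeros of
  \<open>q\<close> and of \<open>bilin q\<close>.\<close>

lemma e_eq_1_iff: "e x = 1 \<longleftrightarrow> x = 0"
proof (transfer)
  fix x :: rat
  have "exp (2 * of_real pi * \<i> * of_rat x) = (1::complex) \<longleftrightarrow>
      (\<exists>k::int. 2 * pi * of_rat x = of_int (2 * k) * pi)"
    by (auto simp: exp_eq_1 complex_of_rat_eq)
  also have "\<dots> \<longleftrightarrow> (\<exists>k::int. (of_rat x :: real) = of_rat (of_int k))"
    by auto
  also have "\<dots> \<longleftrightarrow> x - 0 \<in> \<int>"
    by (auto simp: Ints_def simp del: of_rat_of_int_eq)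
  finally show "exp (2 * of_real pi * \<i> * of_rat x) = (1::complex) \<longleftrightarrow> x - 0 \<in> \<int>" .
qed

lemma rat_class_divide_eq_0_iff:
  assumes "m > 0"
  shows "rat_class (of_int k / of_nat m) = 0 \<longleftrightarrow> int m dvd k"
proof -
  have "rat_class (of_int k / of_nat m) = 0 \<longleftrightarrow> of_int k / rat_of_nat m \<in> \<int>"
    by (simp add: zero_rat_mod_int_def rat_mod_int.abs_eq_iff)
  also have "\<dots> \<longleftrightarrow> int m dvd k"
    using of_int_div_of_int_in_Ints_iff[of k "int m", where 'a = rat] assms by auto
  finally show ?thesis .
qed

lemma e_zmult_nat: "e (zmult (int k) x) = e x ^ k"
  by (induction k) (simp_all add: zmult_add e_add)

text \<open>A geometric series with ratio \<open>e x\<close>, a root of unity of order dividing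
  \<open>p\<close> that equals 1 only for \<open>x = 0\<close>. It later expands the indicator of
  \<open>q \<gamma> = 0\<close> in characters.\<close>

lemma sum_e_zmult:
  assumes "zmult (int p) x = 0" "p > 0"
  shows "(\<Sum>t\<in>{0..<int p}. e (zmult t x)) = (if x = 0 then of_nat p else 0)"
proof (cases "x = 0")
  case True
  then show ?thesis by simp
next
  case False
  have "(\<Sum>t\<in>{0..<int p}. e (zmult t x)) = (\<Sum>t<p. e x ^ t)"
    by (rule sum.reindex_bij_witness[of _ int nat]) (auto simp: e_zmult_nat simp flip: e_zmult_nat)
  also have "\<dots> = (e x ^ p - 1) / (e x - 1)"
    using False by (simp add: geometric_sum e_eq_1_iff)
  also have "e x ^ p = 1"
    using assms by (simp flip: e_zmult_nat)
  finally show ?thesis using False by simp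
qed

lemma e_sum: "e (\<Sum>i\<in>A. f i) = (\<Prod>i\<in>A. e (f i))"
  by (induction A rule: infinite_finite_induct) (simp_all add: e_add)

lemma zmult_sum: "zmult k (\<Sum>i\<in>A. f i) = (\<Sum>i\<in>A. zmult k (f i))"
  by (induction A rule: infinite_finite_induct) (simp_all add: zmult_add_right)

lemma sum_constant_zmult: "(\<Sum>i\<in>A. x) = zmult (int (card A)) x"
  by (induction A rule: infinite_finite_induct) (simp_all add: zmult_add)

text \<open>In a basis \<open>B\<close> of \<open>W\<close>, the map \<open>P\<close> is a sum of
  rank-one maps, one for each \<open>w\<close> in \<open>B\<close>, each of trace 1. The two
  conditions on \<open>W\<close> make \<open>P\<close> idempotent with image \<open>W\<close>, so
  \<open>W\<close> is a subspace.\<close>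

lemma trace_idempotent_eq_dim:
  fixes P :: "complex^'d \<Rightarrow> complex^'d"
  assumes lin: "Vector_Spaces.linear (*s) (*s) P"
    and range: "\<And>v. P v \<in> W" and ident: "\<And>v. v \<in> W \<Longrightarrow> P v = v"
  shows "(\<Sum>i\<in>UNIV. P (axis i 1) $ i) = of_nat (vec.dim W)"
proof -
  interpret P: Vector_Spaces.linear "(*s)" "(*s)" P by (rule lin)
  have W: "W = range P" using range ident by (metis image_eqI subset_antisym image_subset_iff rangeE UNIV_I subsetI)
  have "vec.subspace W" unfolding W
    using P.subspace_image[OF vec.subspace_UNIV] .
  obtain B where B: "B \<subseteq> W" "vec.independent B" "W \<subseteq> vec.span B" "card B = vec.dim W"
    using vec.basis_exists by blast
  have spanB: "vec.span B = W"
    using B \<open>vec.subspace W\<close> by (metis vec.span_minimal subset_antisym)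
  have finB: "finite B" using B(2) by (rule vec.finiteI_independent)
  \<comment> \<open>The \<open>w\<close>-coordinate of \<open>P v\<close>: a linear functional on
    the whole space, as \<open>P\<close> lands in the span of \<open>B\<close>.\<close>
  define \<phi> where "\<phi> w v = vec.representation B (P v) w" for w v
  have PB: "P v = (\<Sum>w\<in>B. \<phi> w v *s w)" for v
    unfolding \<phi>_def using vec.sum_representation_eq[OF B(2) _ finB order.refl, of "P v"] range spanB by simp
  have Pspan: "P v \<in> vec.span B" for v using range spanB by simp
  have "(\<Sum>i\<in>UNIV. P (axis i 1) $ i) = (\<Sum>i\<in>UNIV. \<Sum>w\<in>B. \<phi> w (axis i 1) * w $ i)"
    by (simp add: PB)
  also have "\<dots> = (\<Sum>w\<in>B. \<Sum>i\<in>UNIV. w $ i * \<phi> w (axis i 1))"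
    by (subst sum.swap) (simp add: mult_ac)
  also have "\<dots> = (\<Sum>w\<in>B. \<phi> w w)"
  proof (rule sum.cong[OF refl])
    fix w assume "w \<in> B"
    have "\<phi> w w = \<phi> w (\<Sum>i\<in>UNIV. w $ i *s axis i 1)" by (simp add: basis_expansion)
    also have "\<dots> = (\<Sum>i\<in>UNIV. w $ i * \<phi> w (axis i 1))"
      using Pspan by (simp add: \<phi>_def P.sum P.scale vec.representation_sum vec.representation_scale B(2) vec.span_scale)
    finally show "(\<Sum>i\<in>UNIV. w $ i * \<phi> w (axis i 1)) = \<phi> w w" by simp
  qed
  also have "\<dots> = (\<Sum>w\<in>B. 1)"
    using B ident by (intro sum.cong) (auto simp: \<phi>_def vec.representation_basis subset_iff)
  also have "\<dots> = of_nat (vec.dim W)" using B by simp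
  finally show ?thesis .
qed

subsection \<open>Generators of the modular group and quadratic Gauss sums\<close>

lemma matrix_mult_2x2:
  "(vector [vector [a, b], vector [c, d]] :: int^2^2) ** (vector [vector [a', b'], vector [c', d']] :: int^2^2) =
    vector [vector [a * a' + b * c', a * b' + b * d'], vector [c * a' + d * c', c * b' + d * d']]"
  by (simp add: vec_eq_iff forall_2 matrix_matrix_mult_def sum_2 vector_2)

lemma SL2Z_2x2_iff:
  "(vector [vector [a, b], vector [c, d]] :: int^2^2) \<in> SL2Z \<longleftrightarrow> a * d - b * c = 1"
  by (simp add: SL2Z_def det_2 vector_2)

text \<open>The Euclidean algorithm on the first column. Left cancellation stands in for closure
  under inverses, and both rules are confined to \<open>SL2Z\<close> because a Weil representation
  is constrained only there.\<close>

lemma SL2Z_subset_if_generators: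
  assumes S: "matS \<in> H" and T: "matT \<in> H"
    and mult: "\<And>M N. M \<in> SL2Z \<Longrightarrow> N \<in> SL2Z \<Longrightarrow> M \<in> H \<Longrightarrow> N \<in> H \<Longrightarrow> M ** N \<in> H"
    and cancel: "\<And>M N. M \<in> SL2Z \<Longrightarrow> N \<in> SL2Z \<Longrightarrow> M \<in> H \<Longrightarrow> M ** N \<in> H \<Longrightarrow> N \<in> H"
  shows "SL2Z \<subseteq> H"
proof -
  define mk :: "int \<Rightarrow> int \<Rightarrow> int \<Rightarrow> int \<Rightarrow> int^2^2"
    where "mk a b c d = vector [vector [a, b], vector [c, d]]" for a b c d
  have mk_mult: "mk a b c d ** mk a' b' c' d' =
      mk (a * a' + b * c') (a * b' + b * d') (c * a' + d * c') (c * b' + d * d')"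
    for a b c d a' b' c' d' unfolding mk_def by (rule matrix_mult_2x2)
  have mk_SL2Z: "mk a b c d \<in> SL2Z \<longleftrightarrow> a * d - b * c = 1" for a b c d
    unfolding mk_def by (rule SL2Z_2x2_iff)
  have S': "mk 0 (-1) 1 0 \<in> H" using S by (simp add: mk_def matS_def)
  have T': "mk 1 1 0 1 \<in> H" using T by (simp add: mk_def matT_def)
  have Sinv: "M \<in> H" if "M \<in> SL2Z" "mk 0 (-1) 1 0 ** M \<in> H" for M
    using cancel[OF _ that(1) S' that(2)] by (simp add: mk_SL2Z)
  \<comment> \<open>The square of \<open>matS\<close> is minus the identity.\<close>
  have neg: "mk (-1) 0 0 (-1) \<in> H"
    using mult[OF _ _ S' S'] by (simp add: mk_SL2Z mk_mult)
  have one: "mk 1 0 0 1 \<in> H"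
    using mult[OF _ _ neg neg] by (simp add: mk_SL2Z mk_mult)
  have Tk: "mk 1 k 0 1 \<in> H" for k
  proof (induction k rule: int_induct[where k = 0])
    case base
    show ?case by (rule one)
  next
    case (step1 i)
    then show ?case using mult[OF _ _ T' step1(2)] by (simp add: mk_SL2Z mk_mult)
  next
    case (step2 i)
    then show ?case using cancel[OF _ _ T', of "mk 1 (i - 1) 0 1"] by (simp add: mk_SL2Z mk_mult)
  qed
  have main: "mk a b c d \<in> H" if "a * d - b * c = 1" for a b c d
    using that
  proof (induction "nat \<bar>c\<bar>" arbitrary: a b c d rule: less_induct)
    case less
    show ?case
    proof (cases "c = 0")
      case True
      then have "a * d = 1" using less.prems by simp
      then consider "a = 1" "d = 1" | "a = -1" "d = -1"
        using zmult_eq_1_iff by blast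
      then show ?thesis
      proof cases
        case 1
        then show ?thesis using True Tk by simp
      next
        case 2
        then show ?thesis using mult[OF _ _ neg Tk[of "- b"]] True
          by (simp add: mk_SL2Z mk_mult)
      qed
    next
      case False
      \<comment> \<open>Multiplying by the power \<open>- k\<close> of \<open>matT\<close> turns
        \<open>a\<close> into \<open>a mod c\<close>; a further \<open>matS\<close> moves that entry
        to the lower left, where it is smaller than \<open>c\<close> in absolute value.
        \<open>Sinv\<close> and the power \<open>k\<close> of \<open>matT\<close> undo this.\<close>
      define k where "k = a div c"
      have r: "a mod c = a - k * c" unfolding k_def by (simp add: minus_div_mult_eq_mod)
      have "nat \<bar>a mod c\<bar> < nat \<bar>c\<bar>" using False by (simp add: abs_mod_less)
      moreover have "(a - k * c) * d - (b - k * d) * c = a * d - b * c"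
          "- c * (b - k * d) - - d * (a - k * c) = a * d - b * c"
        by (simp_all add: algebra_simps)
      then have det: "(a - k * c) * d - (b - k * d) * c = 1"
          "- c * (b - k * d) - - d * (a - k * c) = 1"
        by (simp_all only: less.prems)
      ultimately have "mk (- c) (- d) (a - k * c) (b - k * d) \<in> H"
        by (intro less.hyps) (simp_all only: r det)
      then have "mk (a - k * c) (b - k * d) c d \<in> H"
        using det(1) by - (rule Sinv, simp_all add: mk_SL2Z mk_mult)
      from mult[OF _ _ Tk[of k] this] det(1) show ?thesis
        by (simp add: mk_SL2Z mk_mult)
    qed
  qed
  show ?thesis
  proof
    fix M :: "int^2^2" assume "M \<in> SL2Z"
    moreover have "M = mk (M $ 1 $ 1) (M $ 1 $ 2) (M $ 2 $ 1) (M $ 2 $ 2)"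
      by (simp add: mk_def vec_eq_iff forall_2 vector_2)
    ultimately show "M \<in> H" using main mk_SL2Z by metis
  qed
qed

text \<open>Invariance under \<open>mod int p\<close> encodes a function on residue classes. A map
  injective modulo \<open>p\<close> permutes the finitely many classes.\<close>

lemma sum_residues_reindex:
  fixes f :: "int \<Rightarrow> 'b::comm_monoid_add"
  assumes "p > 0" "\<And>x. f (x mod int p) = f x"
    and inj: "\<And>x y. [h x = h y] (mod int p) \<Longrightarrow> [x = y] (mod int p)"
  shows "(\<Sum>x\<in>{0..<int p}. f (h x)) = (\<Sum>x\<in>{0..<int p}. f x)"
proof -
  let ?h = "\<lambda>x. h x mod int p"
  have "inj_on ?h {0..<int p}"
  proof (rule inj_onI)
    fix x y assume "x \<in> {0..<int p}" "y \<in> {0..<int p}" "?h x = ?h y"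
    then show "x = y" using inj[of x y] by (simp add: cong_def)
  qed
  moreover from this have "?h ` {0..<int p} = {0..<int p}"
    using \<open>p > 0\<close> by (intro endo_inj_surj) auto
  ultimately have "bij_betw ?h {0..<int p} {0..<int p}" by (simp add: bij_betw_def)
  from sum.reindex_bij_betw[OF this, of f] show ?thesis by (simp add: assms)
qed

lemma sum_residues_mult:
  fixes f :: "int \<Rightarrow> 'b::comm_monoid_add"
  assumes "prime p" "\<not> int p dvd a" "\<And>x. f (x mod int p) = f x"
  shows "(\<Sum>x\<in>{0..<int p}. f (a * x)) = (\<Sum>x\<in>{0..<int p}. f x)"
proof (rule sum_residues_reindex)
  have "coprime a (int p)" using assms(1,2)
    by (metis coprime_commute prime_imp_coprime prime_nat_int_transfer)
  then show "[x = y] (mod int p)" if "[a * x = a * y] (mod int p)" for x y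
    using that by (simp add: cong_mult_lcancel)
qed (use assms prime_gt_0_nat in auto)

lemma sum_residues_shift:
  fixes f :: "int \<Rightarrow> 'b::comm_monoid_add"
  assumes "p > 0" "\<And>x. f (x mod int p) = f x"
  shows "(\<Sum>x\<in>{0..<int p}. f (x + a)) = (\<Sum>x\<in>{0..<int p}. f x)"
  by (rule sum_residues_reindex) (use assms in \<open>auto simp: cong_add_rcancel\<close>)

section \<open>Legendre symbols and quadratic Gauss sums modulo an odd prime\<close>

context
  fixes p :: nat
  assumes prime_p: "prime p" and odd_p: "odd p"
begin

lemma p_gt_2: "p > 2"
  using prime_p odd_p by (metis even_numeral le_neq_implies_less prime_ge_2_nat)

lemma Legendre_cong: "[a = b] (mod int p) \<Longrightarrow> Legendre a (int p) = Legendre b (int p)"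
  by (simp add: Legendre_def QuadRes_def cong_def)

lemma Legendre_mod [simp]: "Legendre (a mod int p) (int p) = Legendre a (int p)"
  by (rule Legendre_cong) simp

text \<open>By Euler's criterion both sides agree modulo \<open>p\<close>, and they differ by at
  most 2, which is less than \<open>p\<close>.\<close>

lemma Legendre_mult: "Legendre (a * b) (int p) = Legendre a (int p) * Legendre b (int p)"
proof -
  have *: "[Legendre x (int p) = x ^ ((p - 1) div 2)] (mod int p)" for x
    using euler_criterion[OF prime_p p_gt_2] .
  have "[Legendre a (int p) * Legendre b (int p) = (a * b) ^ ((p - 1) div 2)] (mod int p)"
    unfolding power_mult_distrib by (intro cong_mult *)
  then have "[Legendre (a * b) (int p) = Legendre a (int p) * Legendre b (int p)] (mod int p)"
    using *[of "a * b"] cong_trans cong_sym by blast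
  then have "int p dvd Legendre (a * b) (int p) - Legendre a (int p) * Legendre b (int p)"
    by (simp add: cong_iff_dvd_diff)
  moreover have "\<bar>Legendre (a * b) (int p) - Legendre a (int p) * Legendre b (int p)\<bar> < int p"
    using p_gt_2 by (simp add: Legendre_def)
  ultimately show ?thesis
    by (metis dvd_imp_le_int not_less eq_iff_diff_eq_0 abs_of_nat)
qed

lemma Legendre_square: "\<not> int p dvd a \<Longrightarrow> Legendre a (int p) * Legendre a (int p) = 1"
  by (simp add: Legendre_def cong_iff_dvd_diff)

text \<open>The roots of a nonzero square are \<open>z\<close> and \<open>int p - z\<close>, since
  \<open>int p\<close> divides \<open>(x - z) * (x + z)\<close>; they are distinct because
  \<open>p\<close> is odd. Zero has one root.\<close>

lemma card_square_roots:
  assumes y: "y \<in> {0..<int p}"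
  shows "int (card {x \<in> {0..<int p}. x\<^sup>2 mod int p = y}) = 1 + Legendre y (int p)"
proof -
  let ?R = "{x \<in> {0..<int p}. x\<^sup>2 mod int p = y}"
  have prime_int: "prime (int p)" using prime_p by simp
  have R: "x \<in> ?R \<longleftrightarrow> x \<in> {0..<int p} \<and> [x\<^sup>2 = y] (mod int p)" for x
    using y by (auto simp: cong_def)
  show ?thesis
  proof (cases "y = 0")
    case True
    have "?R = {0}"
      using True p_gt_2 prime_int
      by (auto simp: mod_eq_0_iff_dvd prime_dvd_power_iff dest: zdvd_imp_le)
    then show ?thesis using True by (simp add: Legendre_def)
  next
    case False
    then have ny: "\<not> int p dvd y" using y by (auto dest: zdvd_imp_le)
    show ?thesis
    proof (cases "QuadRes (int p) y")
      case False
      then have "?R = {}" using R unfolding QuadRes_def by blast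
      then show ?thesis using False ny
        by (simp only: card.empty) (simp add: Legendre_def cong_iff_dvd_diff)
    next
      case True
      then obtain z0 where z0: "[z0\<^sup>2 = y] (mod int p)" unfolding QuadRes_def by blast
      define z where "z = z0 mod int p"
      have z: "[z\<^sup>2 = y] (mod int p)"
        using z0 by (simp add: z_def cong_def power_mod)
      have zr: "z \<in> {0..<int p}" using p_gt_2 by (simp add: z_def)
      have "z \<noteq> 0" using z ny by (auto simp: cong_def mod_eq_0_iff_dvd)
      have "?R = {z, int p - z}"
      proof (intro Set.set_eqI iffI)
        fix x assume "x \<in> ?R"
        then have x: "x \<in> {0..<int p}" "[x\<^sup>2 = z\<^sup>2] (mod int p)"
          using R z cong_sym cong_trans by blast+
        then have "int p dvd (x - z) * (x + z)"
          by (simp add: cong_iff_dvd_diff power2_eq_square algebra_simps)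
        then have "int p dvd x - z \<or> int p dvd x + z"
          using prime_int by (simp add: prime_dvd_mult_iff)
        then show "x \<in> {z, int p - z}"
        proof
          assume "int p dvd x - z"
          then have "x mod int p = z mod int p" by (simp add: mod_eq_dvd_iff)
          then show ?thesis using x zr by simp
        next
          assume "int p dvd x + z"
          then have "x mod int p = (int p - z) mod int p"
            by (simp add: mod_eq_dvd_iff)
          moreover have "x mod int p = x" using x by simp
          moreover have "(int p - z) mod int p = int p - z"
            using zr \<open>z \<noteq> 0\<close> by (intro mod_pos_pos_trivial) auto
          ultimately show ?thesis by simp
        qed
      next
        fix x assume "x \<in> {z, int p - z}"
        moreover have "[(int p - z)\<^sup>2 = z\<^sup>2] (mod int p)"
          by (simp add: cong_iff_dvd_diff power2_eq_square algebra_simps)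
        ultimately show "x \<in> ?R"
          using R zr z \<open>z \<noteq> 0\<close> cong_trans by auto
      qed
      moreover have "z \<noteq> int p - z" using odd_p by presburger
      ultimately show ?thesis using True ny
        by (simp add: Legendre_def cong_iff_dvd_diff)
    qed
  qed
qed

text \<open>Grouping by the value of the square trades a quadratic argument for a linear one
  weighted by a Legendre symbol.\<close>

lemma sum_squares_residues:
  fixes f :: "int \<Rightarrow> complex"
  assumes "\<And>x. f (x mod int p) = f x"
  shows "(\<Sum>x\<in>{0..<int p}. f (x\<^sup>2)) = (\<Sum>y\<in>{0..<int p}. (1 + of_int (Legendre y (int p))) * f y)"
proof -
  have "(\<Sum>x\<in>{0..<int p}. f (x\<^sup>2)) = (\<Sum>x\<in>{0..<int p}. f (x\<^sup>2 mod int p))"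
    by (simp add: assms)
  also have "\<dots> = (\<Sum>y\<in>{0..<int p}. \<Sum>x\<in>{x \<in> {0..<int p}. x\<^sup>2 mod int p = y}. f (x\<^sup>2 mod int p))"
    using p_gt_2 by (intro sum.group[symmetric]) auto
  also have "\<dots> = (\<Sum>y\<in>{0..<int p}. of_int (int (card {x \<in> {0..<int p}. x\<^sup>2 mod int p = y})) * f y)"
    by (intro sum.cong refl) simp
  also have "\<dots> = (\<Sum>y\<in>{0..<int p}. (1 + of_int (Legendre y (int p))) * f y)"
    by (intro sum.cong refl) (simp only: card_square_roots of_int_add of_int_1)
  finally show ?thesis .
qed

text \<open>For the constant function 1, the count \<open>p\<close> occurs on both sides of the
  preceding identity and cancels.\<close>

lemma sum_Legendre: "(\<Sum>y\<in>{0..<int p}. complex_of_int (Legendre y (int p))) = 0"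
  using sum_squares_residues[of "\<lambda>_. 1"] by (simp add: sum.distrib)

definition root_char :: "int \<Rightarrow> complex" where
  "root_char k = e (rat_class (of_int k / of_nat p))"

definition gauss_sum :: "int \<Rightarrow> complex" where
  "gauss_sum a = (\<Sum>x\<in>{0..<int p}. root_char (a * x\<^sup>2))"

lemma root_char_add: "root_char (k + l) = root_char k * root_char l"
proof -
  have "rat_class (of_int (k + l) / of_nat p) = rat_class (of_int k / of_nat p) + rat_class (of_int l / of_nat p)"
    by (simp add: add_divide_distrib plus_rat_mod_int.abs_eq)
  then show ?thesis by (simp add: root_char_def e_add)
qed

lemma rat_class_eq_0_iff: "rat_class (of_int k / of_nat p) = 0 \<longleftrightarrow> int p dvd k"
  using p_gt_2 by (simp add: rat_class_divide_eq_0_iff)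

lemma root_char_mod: "root_char (k mod int p) = root_char k"
proof -
  have "root_char (int p * (k div int p)) = 1"
    by (simp only: root_char_def e_eq_1_iff rat_class_eq_0_iff) simp
  then show ?thesis
    using root_char_add[of "int p * (k div int p)" "k mod int p"] by simp
qed

lemma root_char_cong: "[k = l] (mod int p) \<Longrightarrow> root_char k = root_char l"
  by (metis cong_def root_char_mod)

lemma sum_root_char:
  "(\<Sum>x\<in>{0..<int p}. root_char (a * x)) = (if int p dvd a then of_nat p else 0)"
proof -
  have "zmult (int p) (rat_class (of_int a / of_nat p)) = 0"
    using rat_class_eq_0_iff[of "int p * a"] by (simp add: zmult_rat_class)
  from sum_e_zmult[OF this] p_gt_2 show ?thesis
    by (simp add: rat_class_eq_0_iff zmult_rat_class root_char_def mult.commute)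
qed

text \<open>As a sum of Legendre symbols times \<open>root_char (a * y)\<close>, the Gauss sum can
  be reindexed by \<open>a * y\<close>; multiplicativity of the symbol then pulls out the
  factor.\<close>

lemma gauss_sum_eq_Legendre:
  assumes "\<not> int p dvd a"
  shows "gauss_sum a = of_int (Legendre a (int p)) * gauss_sum 1"
proof -
  let ?L = "\<lambda>y. complex_of_int (Legendre y (int p))"
  \<comment> \<open>The summand 1 in \<open>1 + Legendre\<close> contributes a complete character
    sum, which vanishes.\<close>
  have *: "gauss_sum b = (\<Sum>y\<in>{0..<int p}. ?L y * root_char (b * y))" if "\<not> int p dvd b" for b
  proof -
    have "root_char (b * (x mod int p)) = root_char (b * x)" for x
      by (intro root_char_cong) (simp add: cong_def mod_mult_right_eq)
    from sum_squares_residues[of "\<lambda>x. root_char (b * x)", OF this] show ?thesis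
      using that by (simp add: gauss_sum_def distrib_right sum.distrib sum_root_char)
  qed
  have "\<not> int p dvd 1" using p_gt_2 by simp
  have "?L a * ?L a = 1" using Legendre_square[OF assms] by (metis of_int_1 of_int_mult)
  then have "gauss_sum a = (\<Sum>y\<in>{0..<int p}. ?L a * (?L (a * y) * root_char (a * y)))"
    unfolding *[OF assms] by (intro sum.cong refl) (simp add: Legendre_mult flip: mult.assoc)
  also have "\<dots> = ?L a * (\<Sum>y\<in>{0..<int p}. ?L (a * y) * root_char (a * y))"
    by (simp add: sum_distrib_left)
  also have "(\<Sum>y\<in>{0..<int p}. ?L (a * y) * root_char (a * y)) = (\<Sum>y\<in>{0..<int p}. ?L y * root_char y)"
    by (rule sum_residues_mult[OF prime_p assms]) (simp add: root_char_mod)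
  also have "\<dots> = gauss_sum 1" using *[OF \<open>\<not> int p dvd 1\<close>] by simp
  finally show ?thesis .
qed

text \<open>The product of the Gauss sums at 1 and -1 equals \<open>p\<close>, and the second is the
  Legendre symbol of -1 times the first.\<close>

lemma gauss_sum_square: "(gauss_sum 1)\<^sup>2 = of_int (Legendre (-1) (int p)) * of_nat p"
proof -
  have n1: "\<not> int p dvd -1" using p_gt_2 by simp
  have sq: "[(x mod int p)\<^sup>2 = x\<^sup>2] (mod int p)" for x by (simp add: cong_def power_mod)
  have "gauss_sum 1 * gauss_sum (-1) =
      (\<Sum>y\<in>{0..<int p}. \<Sum>x\<in>{0..<int p}. root_char (x\<^sup>2 - y\<^sup>2))"
    by (subst sum.swap) (simp add: gauss_sum_def sum_product flip: root_char_add)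
  \<comment> \<open>After this shift the exponent is \<open>x\<^sup>2 + 2 * x * y\<close>, linear in
    \<open>y\<close>, so the sum over \<open>y\<close> vanishes unless \<open>x = 0\<close>.\<close>
  also have "\<dots> = (\<Sum>y\<in>{0..<int p}. \<Sum>x\<in>{0..<int p}. root_char ((x + y)\<^sup>2 - y\<^sup>2))"
    using p_gt_2 by (intro sum.cong refl sum_residues_shift[symmetric] root_char_cong cong_diff sq) auto
  also have "\<dots> = (\<Sum>x\<in>{0..<int p}. root_char (x\<^sup>2) * (\<Sum>y\<in>{0..<int p}. root_char (2 * x * y)))"
    by (subst sum.swap) (simp add: sum_distrib_left power2_eq_square algebra_simps flip: root_char_add)
  also have "\<dots> = (\<Sum>x\<in>{0..<int p}. if x = 0 then of_nat p else 0)"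
  proof (intro sum.cong refl)
    fix x assume x: "x \<in> {0..<int p}"
    have "prime (int p)" using prime_p by simp
    then have "int p dvd 2 * x \<longleftrightarrow> int p dvd x"
      using p_gt_2 by (auto simp: prime_dvd_mult_iff dest: zdvd_imp_le)
    also have "\<dots> \<longleftrightarrow> x = 0" using x by (auto dest: zdvd_imp_le)
    finally show "root_char (x\<^sup>2) * (\<Sum>y\<in>{0..<int p}. root_char (2 * x * y)) =
        (if x = 0 then of_nat p else 0)"
      by (simp add: sum_root_char) (simp add: root_char_def flip: zero_rat_mod_int_def)
  qed
  also have "\<dots> = of_nat p" using p_gt_2 by simp
  finally have "gauss_sum 1 * (of_int (Legendre (-1) (int p)) * gauss_sum 1) = of_nat p"
    using gauss_sum_eq_Legendre[OF n1] by simp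
  then have "of_int (Legendre (-1) (int p) * Legendre (-1) (int p)) * (gauss_sum 1)\<^sup>2 =
      of_int (Legendre (-1) (int p)) * of_nat p"
    by (simp add: power2_eq_square mult_ac)
  then show ?thesis using Legendre_square[OF n1] by simp
qed

end

subsection \<open>The Fourier transform on isotropic elements\<close>

lemma zmult_eq_0_iff:
  assumes "prime p" "zmult (int p) x = 0" "\<not> int p dvd k"
  shows "zmult k x = 0 \<longleftrightarrow> x = 0"
proof
  assume *: "zmult k x = 0"
  have "coprime k (int p)" using assms
    by (metis coprime_commute prime_imp_coprime prime_nat_int_transfer)
  then obtain l where "[k * l = 1] (mod int p)" using cong_solve_coprime_int by blast
  then have "x = zmult (l * k) x"
    using zmult_cong[OF assms(2), of "k * l" 1] by (simp add: mult.commute)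
  then show "x = 0" using * by (simp add: zmult_mult)
qed simp

text \<open>Extension by zero at multiples of \<open>p\<close> reduces this to sums over all
  residues.\<close>

lemma sum_units_mult:
  fixes f :: "int \<Rightarrow> 'b::comm_monoid_add"
  assumes "prime p" "\<not> int p dvd a" "\<And>x. f (x mod int p) = f x"
  shows "(\<Sum>x\<in>{1..<int p}. f (a * x)) = (\<Sum>x\<in>{1..<int p}. f x)"
proof -
  have pi: "prime (int p)" using assms(1) by simp
  have *: "(\<Sum>x\<in>{1..<int p}. h x) = (\<Sum>x\<in>{0..<int p}. if int p dvd x then 0 else h x)"
    for h :: "int \<Rightarrow> 'b"
  proof (rule sum.mono_neutral_cong_left)
    show "\<forall>i\<in>{0..<int p} - {1..<int p}. (if int p dvd i then 0 else h i) = 0"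
    proof
      fix i assume "i \<in> {0..<int p} - {1..<int p}"
      then have "i = 0" by auto
      then show "(if int p dvd i then 0 else h i) = 0" by simp
    qed
  qed (auto dest: zdvd_imp_le)
  have "(\<Sum>x\<in>{1..<int p}. f (a * x)) =
      (\<Sum>x\<in>{0..<int p}. if int p dvd a * x then 0 else f (a * x))"
    unfolding * using assms(2) by (simp add: prime_dvd_mult_iff[OF pi])
  also have "\<dots> = (\<Sum>x\<in>{0..<int p}. if int p dvd x then 0 else f x)"
    by (rule sum_residues_mult[OF assms(1,2)]) (simp add: assms(3) dvd_mod_iff)
  finally show ?thesis unfolding * .
qed

text \<open>Completing the square in \<open>t q(\<gamma>) + (\<gamma>,\<delta>)\<close> leaves a
  remainder with coefficient -1/t modulo \<open>p\<close>. As an involution of the representatives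
  \<open>{1..<int p}\<close>, this map can reindex the sum over \<open>t\<close>.\<close>

lemma negative_inverse_involution:
  assumes "prime p"
  obtains \<nu> :: "int \<Rightarrow> int" where
    "\<And>t. t \<in> {1..<int p} \<Longrightarrow> \<nu> t \<in> {1..<int p}"
    "\<And>t. t \<in> {1..<int p} \<Longrightarrow> [t * \<nu> t = -1] (mod int p)"
    "\<And>t. t \<in> {1..<int p} \<Longrightarrow> \<nu> (\<nu> t) = t"
proof -
  let ?I = "{1..<int p}"
  have p: "p > 1" using assms by (rule prime_gt_1_nat)
  have cop: "coprime t (int p)" if "t \<in> ?I" for t
    using that assms
    by (metis atLeastLessThan_iff coprime_commute linorder_not_le prime_imp_coprime
        prime_nat_int_transfer zdvd_imp_le zero_less_one order_less_le_trans)
  have ex: "\<exists>s. s \<in> ?I \<and> [t * s = -1] (mod int p)" if t: "t \<in> ?I" for t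
  proof -
    obtain u where u: "[t * u = 1] (mod int p)" using cong_solve_coprime_int[OF cop[OF t]] by blast
    have c: "[t * ((- u) mod int p) = -1] (mod int p)"
    proof -
      have "[t * ((- u) mod int p) = t * (- u)] (mod int p)"
        by (intro cong_mult) simp_all
      also have "[t * (- u) = - 1] (mod int p)"
        using u by (simp add: cong_minus_minus_iff)
      finally show ?thesis .
    qed
    have "(- u) mod int p \<noteq> 0"
    proof
      assume "(- u) mod int p = 0"
      with c have "int p dvd 1" by (simp add: cong_iff_dvd_diff)
      then show False using p by simp
    qed
    moreover have "0 \<le> (- u) mod int p" "(- u) mod int p < int p" using p by simp_all
    ultimately have "(- u) mod int p \<in> ?I" by simp
    with c show ?thesis by blast
  qed
  have uniq: "s = s'" if "s \<in> ?I" "s' \<in> ?I" "t \<in> ?I" "[t * s = -1] (mod int p)" "[t * s' = -1] (mod int p)" for s s' t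
  proof -
    have "[t * s = t * s'] (mod int p)" using that cong_sym cong_trans by blast
    then have "[s = s'] (mod int p)" using cop[OF that(3)] by (simp add: cong_mult_lcancel)
    then show ?thesis using that by (simp add: cong_def)
  qed
  define \<nu> where "\<nu> t = (SOME s. s \<in> ?I \<and> [t * s = -1] (mod int p))" for t
  have \<nu>: "\<nu> t \<in> ?I \<and> [t * \<nu> t = -1] (mod int p)" if "t \<in> ?I" for t
    unfolding \<nu>_def using someI_ex[OF ex[OF that]] .
  \<comment> \<open>Both sides solve the congruence defining \<open>\<nu>\<close> at
    \<open>\<nu> t\<close>, whose solution in range is unique.\<close>
  have "\<nu> (\<nu> t) = t" if t: "t \<in> ?I" for t
    using uniq[of "\<nu> (\<nu> t)" t "\<nu> t"] \<nu>[OF t] \<nu>[of "\<nu> t"] t by (simp add: mult.commute)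
  with \<nu> that show ?thesis by blast
qed

text \<open>The data from the orthogonal decomposition on which the dimension count rests:
  \<open>\<eta> t\<close> will be the Legendre symbol of \<open>t\<close> to the power
  \<open>n\<close>, and \<open>G\<close> the Gauss sum of the whole form (the case
  \<open>t = 1\<close>). On units \<open>\<eta>\<close> takes values 1 and -1, so it is its own
  inverse.\<close>

locale elementary_form =
  fixes q :: "'d::{finite,ab_group_add} \<Rightarrow> rat_mod_int" and p :: nat
    and \<eta> :: "int \<Rightarrow> complex" and G :: complex
  assumes prime_p: "prime p" and odd_p: "odd p"
    and form: "discriminant_form q"
    and torsion: "\<And>x :: 'd. zmult (int p) x = 0"
    and gauss: "\<And>t. \<not> int p dvd t \<Longrightarrow> (\<Sum>\<gamma>\<in>UNIV. e (zmult t (q \<gamma>))) = \<eta> t * G"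
    and \<eta>_mult: "\<And>s t. \<eta> (s * t) = \<eta> s * \<eta> t"
    and \<eta>_mod: "\<And>s. \<eta> (s mod int p) = \<eta> s"
    and \<eta>_square: "\<And>s. \<not> int p dvd s \<Longrightarrow> \<eta> s * \<eta> s = 1"
    and G_square: "G * G = \<eta> (-1) * of_nat CARD('d)"
begin

lemma p_gt_1: "p > 1" using prime_p by (rule prime_gt_1_nat)

lemma unit_not_dvd: "t \<in> {1..<int p} \<Longrightarrow> \<not> int p dvd t"
  by (auto dest: zdvd_imp_le)

lemma \<eta>_cong: "[s = t] (mod int p) \<Longrightarrow> \<eta> s = \<eta> t"
  by (metis cong_def \<eta>_mod)

lemma \<eta>_1: "\<eta> 1 = 1"
  using \<eta>_mult[of 1 1] \<eta>_square[of 1] p_gt_1 by simp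

lemma \<eta>_neg_square: "\<eta> (-1) * \<eta> (-1) = 1"
  using \<eta>_square[of "-1"] p_gt_1 by simp

lemma \<eta>_cancel: "\<not> int p dvd s \<Longrightarrow> \<eta> s * (\<eta> s * x) = x"
  by (simp add: \<eta>_square flip: mult.assoc)

section \<open>Torsion and character sums for the form\<close>

lemma q_zmult: "q (zmult k \<gamma>) = zmult (k\<^sup>2) (q \<gamma>)"
  using form by (simp add: discriminant_form_def quadratic_form_def)

lemma bilin_add_left: "bilin q (\<alpha> + \<beta>) \<gamma> = bilin q \<alpha> \<gamma> + bilin q \<beta> \<gamma>"
  using form by (simp add: discriminant_form_def quadratic_form_def)

lemma bilin_add_right: "bilin q \<alpha> (\<beta> + \<gamma>) = bilin q \<alpha> \<beta> + bilin q \<alpha> \<gamma>"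
  using form by (simp add: discriminant_form_def quadratic_form_def)

lemma bilin_sym: "bilin q \<alpha> \<beta> = bilin q \<beta> \<alpha>"
  by (simp add: bilin_def add.commute)

lemma bilin_zmult_left: "bilin q (zmult k \<alpha>) \<beta> = zmult k (bilin q \<alpha> \<beta>)"
  by (rule additive_zmult[of "\<lambda>x. bilin q x \<beta>"]) (rule bilin_add_left)

lemma bilin_zmult_right: "bilin q \<alpha> (zmult k \<beta>) = zmult k (bilin q \<alpha> \<beta>)"
  by (rule additive_zmult[of "\<lambda>x. bilin q \<alpha> x"]) (rule bilin_add_right)

lemma q_add: "q (\<alpha> + \<beta>) = q \<alpha> + q \<beta> + bilin q \<alpha> \<beta>"
  by (simp add: bilin_def)

lemma q_0 [simp]: "q 0 = 0"
  using q_zmult[of 0 0] by simp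

lemma bilin_0_right [simp]: "bilin q \<alpha> 0 = 0"
  by (simp add: bilin_def)

lemma q_minus: "q (- \<gamma>) = q \<gamma>"
  using q_zmult[of "-1" \<gamma>] by (simp add: zmult_minus)

lemma bilin_self: "bilin q \<gamma> \<gamma> = zmult 2 (q \<gamma>)"
proof -
  have two: "zmult 2 x = x + x" for x :: 'd using zmult_add[of 1 1 x] by simp
  have "q (\<gamma> + \<gamma>) = zmult (2 + (1 + 1)) (q \<gamma>)" using q_zmult[of 2 \<gamma>] by (simp add: two)
  then show ?thesis unfolding bilin_def zmult_add by simp
qed

text \<open>Quadratic scaling only shows that \<open>p * p\<close> kills \<open>q \<gamma>\<close>,
  and bilinearity that \<open>2 * p\<close> does. For \<open>p = 2 * m + 1\<close> the combination
  \<open>p * p - m * (2 * p)\<close> is \<open>p\<close>.\<close>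

lemma q_torsion: "zmult (int p) (q \<gamma>) = 0"
proof -
  obtain m where m: "p = 2 * m + 1" using odd_p by (rule oddE)
  have "zmult (int p * int p) (q \<gamma>) = 0"
    using q_zmult[of "int p" \<gamma>] torsion by (simp add: power2_eq_square)
  moreover have "zmult (int p * 2) (q \<gamma>) = 0"
    using bilin_zmult_left[of "int p" \<gamma> \<gamma>] bilin_sym[of 0 \<gamma>]
    by (simp add: torsion bilin_self zmult_mult)
  then have "zmult (int m * (int p * 2)) (q \<gamma>) = 0" by (subst zmult_mult) simp
  ultimately have "zmult (int p * int p - int m * (int p * 2)) (q \<gamma>) = 0"
    by (simp only: zmult_diff) simp
  moreover have "int p * int p - int m * (int p * 2) = int p"
    by (simp add: m algebra_simps)
  ultimately show ?thesis by simp
qed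

lemma bilin_torsion: "zmult (int p) (bilin q \<alpha> \<beta>) = 0"
  using bilin_zmult_left[of "int p" \<alpha> \<beta>] bilin_sym[of 0 \<beta>] by (simp add: torsion)

text \<open>Nondegeneracy gives a translation that multiplies the sum by a number other than 1 when
  \<open>\<delta>\<close> is nonzero.\<close>

lemma sum_e_bilin: "(\<Sum>\<gamma>\<in>UNIV. e (bilin q \<gamma> \<delta>)) = (if \<delta> = 0 then of_nat CARD('d) else 0)"
proof (cases "\<delta> = 0")
  case False
  then obtain \<gamma>\<^sub>0 where \<gamma>\<^sub>0: "bilin q \<gamma>\<^sub>0 \<delta> \<noteq> 0"
    using form bilin_sym unfolding discriminant_form_def by metis
  have "(\<Sum>\<gamma>\<in>UNIV. e (bilin q \<gamma> \<delta>)) = (\<Sum>\<gamma>\<in>UNIV. e (bilin q (\<gamma> + \<gamma>\<^sub>0) \<delta>))"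
    by (rule sum.reindex_bij_witness[of _ "\<lambda>x. x + \<gamma>\<^sub>0" "\<lambda>x. x - \<gamma>\<^sub>0"]) auto
  also have "\<dots> = e (bilin q \<gamma>\<^sub>0 \<delta>) * (\<Sum>\<gamma>\<in>UNIV. e (bilin q \<gamma> \<delta>))"
    by (simp add: bilin_add_left e_add sum_distrib_left mult.commute)
  finally have "(e (bilin q \<gamma>\<^sub>0 \<delta>) - 1) * (\<Sum>\<gamma>\<in>UNIV. e (bilin q \<gamma> \<delta>)) = 0"
    by (simp add: left_diff_distrib)
  then show ?thesis using False \<gamma>\<^sub>0 by (simp add: e_eq_1_iff)
qed simp

lemma residues_eq_insert: "{0..<int p} = insert 0 {1..<int p}"
  using p_gt_1 by auto

text \<open>The indicator of \<open>q \<gamma> = 0\<close> is the average of the characters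
  \<open>e (zmult t (q \<gamma>))\<close>; the term \<open>t = 0\<close> is split off.\<close>

lemma sum_isotropic_eq:
  "of_nat p * (\<Sum>\<gamma>\<in>{\<gamma>. q \<gamma> = 0}. F \<gamma>) =
    (\<Sum>\<gamma>\<in>UNIV. F \<gamma>) + (\<Sum>t\<in>{1..<int p}. \<Sum>\<gamma>\<in>UNIV. e (zmult t (q \<gamma>)) * F \<gamma>)"
proof -
  have "of_nat p * (\<Sum>\<gamma>\<in>{\<gamma>. q \<gamma> = 0}. F \<gamma>) =
      (\<Sum>\<gamma>\<in>UNIV. (\<Sum>t\<in>{0..<int p}. e (zmult t (q \<gamma>))) * F \<gamma>)"
    using p_gt_1 by (simp add: sum_e_zmult q_torsion if_distribR sum.If_cases sum_distrib_left
        if_distrib[of "\<lambda>x. x * _"] cong: if_cong)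
  also have "\<dots> = (\<Sum>t\<in>{0..<int p}. \<Sum>\<gamma>\<in>UNIV. e (zmult t (q \<gamma>)) * F \<gamma>)"
    by (subst sum.swap) (simp add: sum_distrib_right)
  finally show ?thesis by (simp add: residues_eq_insert)
qed

lemma card_isotropic:
  "of_nat p * of_nat (card {\<gamma>. q \<gamma> = 0}) = of_nat CARD('d) + G * (\<Sum>t\<in>{1..<int p}. \<eta> t)"
  using sum_isotropic_eq[of "\<lambda>_. 1"] by (simp add: gauss unit_not_dvd sum_distrib_left mult.commute)

text \<open>Completing the square turns each term \<open>t\<close> of the indicator expansion into a
  Gauss sum times a phase in \<open>q \<delta>\<close>. With
  \<open>\<delta> = \<alpha> + \<beta>\<close> this will be, up to scaling, the kernel of the
  squared compression.\<close>

lemma sum_e_bilin_isotropic: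
  "of_nat p * (\<Sum>\<gamma>\<in>{\<gamma>. q \<gamma> = 0}. e (bilin q \<gamma> \<delta>)) =
    (if \<delta> = 0 then of_nat CARD('d) else 0) +
    \<eta> (-1) * G * (\<Sum>s\<in>{1..<int p}. \<eta> s * e (zmult s (q \<delta>)))"
proof -
  obtain \<nu> where \<nu>: "\<And>t. t \<in> {1..<int p} \<Longrightarrow> \<nu> t \<in> {1..<int p}"
    "\<And>t. t \<in> {1..<int p} \<Longrightarrow> [t * \<nu> t = -1] (mod int p)"
    "\<And>t. t \<in> {1..<int p} \<Longrightarrow> \<nu> (\<nu> t) = t"
    using negative_inverse_involution[OF prime_p] by blast
  have summand: "(\<Sum>\<gamma>\<in>UNIV. e (zmult t (q \<gamma>)) * e (bilin q \<gamma> \<delta>)) =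
      \<eta> (-1) * G * (\<eta> (\<nu> t) * e (zmult (\<nu> t) (q \<delta>)))" if t: "t \<in> {1..<int p}" for t
  proof -
    let ?s = "\<nu> t"
    have s: "\<not> int p dvd ?s" using \<nu>(1)[OF t] by (rule unit_not_dvd)
    have "\<eta> t * \<eta> ?s = \<eta> (-1)" using \<eta>_cong[OF \<nu>(2)[OF t]] by (simp add: \<eta>_mult)
    \<comment> \<open>\<open>\<eta> ?s\<close> is its own inverse.\<close>
    then have \<eta>t: "\<eta> t = \<eta> (-1) * \<eta> ?s"
      using \<eta>_square[OF s] by (metis mult.assoc mult.right_neutral)
    have "[t * (- ?s) = 1] (mod int p)"
      using \<nu>(2)[OF t] by (metis cong_minus_minus_iff minus_minus mult_minus_right)
    then have b: "zmult (t * (- ?s)) (bilin q \<gamma> \<delta>) = bilin q \<gamma> \<delta>" for \<gamma>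
      using zmult_cong[OF bilin_torsion] by (metis zmult_1)
    have "[(t * ?s) * ?s = (-1) * ?s] (mod int p)" using \<nu>(2)[OF t] by (rule cong_scalar_right)
    then have "zmult (t * ?s * ?s) (q \<delta>) = zmult (- ?s) (q \<delta>)"
      using zmult_cong[OF q_torsion] by simp
    then have d: "zmult t (zmult (?s\<^sup>2) (q \<delta>)) = - zmult ?s (q \<delta>)"
      by (simp add: zmult_minus power2_eq_square mult.assoc flip: zmult_mult)
    \<comment> \<open>The completed square: with \<open>t * ?s\<close> congruent to -1, the cross
      term is \<open>bilin q \<gamma> \<delta>\<close> and the quadratic remainder is
      \<open>- zmult ?s (q \<delta>)\<close>.\<close>
    have sq: "zmult t (q \<gamma>) + bilin q \<gamma> \<delta> = zmult t (q (\<gamma> + zmult (- ?s) \<delta>)) + zmult ?s (q \<delta>)" for \<gamma>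
      using b[of \<gamma>, unfolded zmult_mult] by (simp add: q_add zmult_add_right q_zmult bilin_zmult_right d zmult_mult)
    have "(\<Sum>\<gamma>\<in>UNIV. e (zmult t (q \<gamma>)) * e (bilin q \<gamma> \<delta>)) =
        e (zmult ?s (q \<delta>)) * (\<Sum>\<gamma>\<in>UNIV. e (zmult t (q (\<gamma> + zmult (- ?s) \<delta>))))"
      unfolding sum_distrib_left
      by (intro sum.cong refl) (metis sq e_add mult.commute)
    also have "(\<Sum>\<gamma>\<in>UNIV. e (zmult t (q (\<gamma> + zmult (- ?s) \<delta>)))) = (\<Sum>\<gamma>\<in>UNIV. e (zmult t (q \<gamma>)))"
      by (rule sum.reindex_bij_witness[of _ "\<lambda>x. x - zmult (- ?s) \<delta>" "\<lambda>x. x + zmult (- ?s) \<delta>"]) auto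
    also have "\<dots> = \<eta> t * G" using gauss unit_not_dvd[OF t] .
    finally show ?thesis by (simp add: \<eta>t mult_ac)
  qed
  have "(\<Sum>t\<in>{1..<int p}. \<Sum>\<gamma>\<in>UNIV. e (zmult t (q \<gamma>)) * e (bilin q \<gamma> \<delta>)) =
      (\<Sum>t\<in>{1..<int p}. \<eta> (-1) * G * (\<eta> (\<nu> t) * e (zmult (\<nu> t) (q \<delta>))))"
    by (intro sum.cong refl summand)
  also have "\<dots> = (\<Sum>s\<in>{1..<int p}. \<eta> (-1) * G * (\<eta> s * e (zmult s (q \<delta>))))"
    by (rule sum.reindex_bij_witness[of _ \<nu> \<nu>]) (use \<nu> in auto)
  finally show ?thesis
    unfolding sum_isotropic_eq sum_e_bilin by (simp only: sum_distrib_left)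
qed

text \<open>The action of \<open>matS\<close>: since \<open>G\<close> is the Gauss sum of the form,
  Milgram's formula makes \<open>G / of_nat CARD('d)\<close> the constant of the Weil
  representation, here without square roots or signatures.\<close>

definition fourier :: "('d \<Rightarrow> complex) \<Rightarrow> 'd \<Rightarrow> complex" where
  "fourier f \<beta> = G / of_nat CARD('d) * (\<Sum>\<gamma>\<in>UNIV. e (bilin q \<gamma> \<beta>) * f \<gamma>)"

text \<open>Cutting off after \<open>fourier\<close> gives the compression \<open>K\<close> on
  functions supported on isotropic elements.\<close>

definition isotropic_part :: "('d \<Rightarrow> complex) \<Rightarrow> 'd \<Rightarrow> complex" where
  "isotropic_part f \<gamma> = (if q \<gamma> = 0 then f \<gamma> else 0)"

text \<open>The projection onto functions with
  \<open>f (zmult t \<beta>) = \<eta> t * f \<beta>\<close> for units \<open>t\<close>, scaled by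
  \<open>p - 1\<close>.\<close>

definition average :: "('d \<Rightarrow> complex) \<Rightarrow> 'd \<Rightarrow> complex" where
  "average f \<beta> = (\<Sum>s\<in>{1..<int p}. \<eta> s * f (zmult s \<beta>))"

text \<open>The kernel of the composite is the isotropic character sum at
  \<open>\<alpha> + \<beta>\<close>. For isotropic \<open>\<alpha>\<close> and
  \<open>\<beta>\<close> one has \<open>q (\<alpha> + \<beta>) = bilin q \<alpha> \<beta>\<close>,
  so its phases are Fourier kernels at \<open>zmult s \<beta>\<close>, while its delta term gives
  the reflection.\<close>

lemma fourier_fourier_isotropic:
  assumes supp: "\<And>\<gamma>. q \<gamma> \<noteq> 0 \<Longrightarrow> f \<gamma> = 0" and \<beta>: "q \<beta> = 0"
  shows "of_nat p * fourier (isotropic_part (fourier f)) \<beta> =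
    \<eta> (-1) * f (- \<beta>) + average (fourier f) \<beta>"
proof -
  let ?N = "of_nat CARD('d) :: complex" and ?X = "{\<gamma>. q \<gamma> = 0}" and ?I = "{1..<int p}"
  define c where "c = G / ?N"
  have N: "?N \<noteq> 0" by simp
  \<comment> \<open>By \<open>G_square\<close> the constants of the delta term and of the phase term
    collapse to \<open>\<eta> (-1)\<close> and \<open>c\<close>.\<close>
  have cN: "c * c * ?N = \<eta> (-1)"
    using G_square N by (simp add: c_def field_simps)
  have "c * c * (\<eta> (-1) * G) = c * (\<eta> (-1) * (G * G / ?N))" by (simp add: c_def)
  also have "G * G / ?N = \<eta> (-1)" using G_square N by simp
  finally have cG: "c * c * (\<eta> (-1) * G) = c" using \<eta>_neg_square by simp
  have "of_nat p * fourier (isotropic_part (fourier f)) \<beta> =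
      of_nat p * (c * (\<Sum>\<gamma>\<in>?X. e (bilin q \<gamma> \<beta>) * (c * (\<Sum>\<alpha>\<in>UNIV. e (bilin q \<alpha> \<gamma>) * f \<alpha>))))"
    unfolding fourier_def isotropic_part_def c_def
    by (simp add: if_distrib[of "\<lambda>x. _ * x"] sum.If_cases cong: if_cong)
  also have "\<dots> = of_nat p * (c * (\<Sum>\<gamma>\<in>?X. \<Sum>\<alpha>\<in>UNIV. c * f \<alpha> * e (bilin q \<gamma> (\<alpha> + \<beta>))))"
    by (simp add: sum_distrib_left bilin_add_right e_add mult_ac bilin_sym)
  also have "\<dots> = (\<Sum>\<alpha>\<in>UNIV. c * c * f \<alpha> * (of_nat p * (\<Sum>\<gamma>\<in>?X. e (bilin q \<gamma> (\<alpha> + \<beta>)))))"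
    by (subst sum.swap) (simp add: sum_distrib_left mult_ac)
  also have "\<dots> = (\<Sum>\<alpha>\<in>UNIV. (if \<alpha> = - \<beta> then \<eta> (-1) * f (- \<beta>) else 0) +
      c * (\<Sum>s\<in>?I. \<eta> s * (e (bilin q \<alpha> (zmult s \<beta>)) * f \<alpha>)))"
  proof (intro sum.cong refl)
    fix \<alpha>
    show "c * c * f \<alpha> * (of_nat p * (\<Sum>\<gamma>\<in>?X. e (bilin q \<gamma> (\<alpha> + \<beta>)))) =
        (if \<alpha> = - \<beta> then \<eta> (-1) * f (- \<beta>) else 0) +
        c * (\<Sum>s\<in>?I. \<eta> s * (e (bilin q \<alpha> (zmult s \<beta>)) * f \<alpha>))"
    proof (cases "q \<alpha> = 0")
      case False
      then have "f \<alpha> = 0" "\<alpha> \<noteq> - \<beta>" using supp \<beta> by (auto simp: q_minus)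
      then show ?thesis by simp
    next
      case True
      then have "q (\<alpha> + \<beta>) = bilin q \<alpha> \<beta>" using \<beta> by (simp add: q_add)
      then have Z: "of_nat p * (\<Sum>\<gamma>\<in>?X. e (bilin q \<gamma> (\<alpha> + \<beta>))) = (if \<alpha> = - \<beta> then ?N else 0) +
          \<eta> (-1) * G * (\<Sum>s\<in>?I. \<eta> s * e (bilin q \<alpha> (zmult s \<beta>)))"
        by (simp only: sum_e_bilin_isotropic bilin_zmult_right eq_neg_iff_add_eq_0)
      have "c * c * f \<alpha> * (of_nat p * (\<Sum>\<gamma>\<in>?X. e (bilin q \<gamma> (\<alpha> + \<beta>)))) =
          (if \<alpha> = - \<beta> then c * c * ?N * f \<alpha> else 0) +
          c * c * (\<eta> (-1) * G) * (\<Sum>s\<in>?I. \<eta> s * (e (bilin q \<alpha> (zmult s \<beta>)) * f \<alpha>))"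
        unfolding Z by (simp add: sum_distrib_left distrib_left mult_ac)
      then show ?thesis by (simp only: cN cG) simp
    qed
  qed
  also have "\<dots> = \<eta> (-1) * f (- \<beta>) +
      (\<Sum>\<alpha>\<in>UNIV. c * (\<Sum>s\<in>?I. \<eta> s * (e (bilin q \<alpha> (zmult s \<beta>)) * f \<alpha>)))"
    by (simp add: sum.distrib)
  also have "(\<Sum>\<alpha>\<in>UNIV. c * (\<Sum>s\<in>?I. \<eta> s * (e (bilin q \<alpha> (zmult s \<beta>)) * f \<alpha>))) = average (fourier f) \<beta>"
    unfolding average_def fourier_def c_def[symmetric] sum_distrib_left
    by (subst sum.swap) (simp add: mult_ac)
  finally show ?thesis .
qed

text \<open>Substitute \<open>t * s\<close> for \<open>s\<close>; the factor \<open>\<eta> t\<close>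
  survives because it is its own inverse.\<close>

lemma average_zmult:
  assumes "\<not> int p dvd t"
  shows "average f (zmult t \<beta>) = \<eta> t * average f \<beta>"
proof -
  have "average f (zmult t \<beta>) = (\<Sum>s\<in>{1..<int p}. \<eta> t * (\<eta> (t * s) * f (zmult (t * s) \<beta>)))"
    unfolding average_def
  proof (intro sum.cong refl)
    fix s
    have "zmult s (zmult t \<beta>) = zmult (t * s) \<beta>" by (simp add: mult.commute[of t] zmult_mult)
    then show "\<eta> s * f (zmult s (zmult t \<beta>)) = \<eta> t * (\<eta> (t * s) * f (zmult (t * s) \<beta>))"
      by (simp add: \<eta>_mult mult.assoc \<eta>_cancel[OF assms])
  qed
  also have "\<dots> = \<eta> t * (\<Sum>s\<in>{1..<int p}. \<eta> (t * s) * f (zmult (t * s) \<beta>))"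
    by (simp add: sum_distrib_left)
  also have "(\<Sum>s\<in>{1..<int p}. \<eta> (t * s) * f (zmult (t * s) \<beta>)) = average f \<beta>"
    unfolding average_def
    by (rule sum_units_mult[OF prime_p assms])
       (simp add: \<eta>_mod zmult_mod torsion)
  finally show ?thesis .
qed

lemma average_equivariant:
  assumes "\<And>t. t \<in> {1..<int p} \<Longrightarrow> f (zmult t \<beta>) = \<eta> t * f \<beta>"
  shows "average f \<beta> = (of_nat p - 1) * f \<beta>"
proof -
  have "average f \<beta> = (\<Sum>s\<in>{1..<int p}. f \<beta>)"
    unfolding average_def
    using assms \<eta>_cancel unit_not_dvd by (intro sum.cong refl) simp
  then show ?thesis using p_gt_1 by (simp add: of_nat_diff)
qed

text \<open>The kernel allows \<open>zmult t\<close> to be moved from one argument to the other, and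
  this scaling permutes the group.\<close>

lemma fourier_equivariant:
  assumes f: "\<And>\<gamma>. f (zmult t \<gamma>) = \<eta> t * f \<gamma>" and t: "\<not> int p dvd t"
  shows "fourier f (zmult t \<beta>) = \<eta> t * fourier f \<beta>"
proof -
  have "inj (zmult t :: 'd \<Rightarrow> 'd)"
  proof (rule injI)
    fix x y :: 'd assume "zmult t x = zmult t y"
    then have "zmult t (x + - y) = 0" by (simp only: zmult_add_right zmult_minus_right) simp
    then show "x = y" using zmult_eq_0_iff[OF prime_p torsion t] by simp
  qed
  then have bij: "bij (zmult t :: 'd \<Rightarrow> 'd)" by (simp add: finite_UNIV_inj_surj bij_def)
  have "(\<Sum>\<gamma>\<in>UNIV. e (bilin q \<gamma> (zmult t \<beta>)) * f \<gamma>) =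
      \<eta> t * (\<Sum>\<gamma>\<in>UNIV. e (bilin q (zmult t \<gamma>) \<beta>) * f (zmult t \<gamma>))"
    unfolding sum_distrib_left
    by (intro sum.cong refl)
       (simp add: f bilin_zmult_left bilin_zmult_right mult.left_commute[of "e _"] \<eta>_cancel[OF t])
  also have "(\<Sum>\<gamma>\<in>UNIV. e (bilin q (zmult t \<gamma>) \<beta>) * f (zmult t \<gamma>)) = (\<Sum>\<gamma>\<in>UNIV. e (bilin q \<gamma> \<beta>) * f \<gamma>)"
    by (rule sum.reindex_bij_betw[OF bij])
  finally show ?thesis by (simp add: fourier_def)
qed

text \<open>Orthogonality of characters leaves the diagonal, weighted by
  \<open>c * cnj c * of_nat CARD('d)\<close>. This is 1: \<open>G_square\<close> fixes the norm of
  \<open>G\<close> since \<open>\<eta> (-1)\<close> has norm 1.\<close>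

lemma parseval: "(\<Sum>\<beta>\<in>UNIV. (norm (fourier f \<beta>))\<^sup>2) = (\<Sum>\<gamma>\<in>UNIV. (norm (f \<gamma>))\<^sup>2)"
proof -
  let ?N = "of_nat CARD('d) :: complex"
  define c where "c = G / ?N"
  have "c * c * ?N = \<eta> (-1)"
    using G_square by (simp add: c_def field_simps)
  then have "norm c * norm c * real CARD('d) = norm (\<eta> (-1))"
    by (metis norm_mult norm_of_nat)
  moreover have "norm (\<eta> (-1)) * norm (\<eta> (-1)) = 1"
    using \<eta>_neg_square by (metis norm_mult norm_one)
  then have "norm (\<eta> (-1)) = 1"
    by (metis abs_norm_cancel abs_square_eq_1 power2_eq_square)
  ultimately have "complex_of_real (norm c * norm c * real CARD('d)) = 1" by simp
  moreover have "of_real (norm c * norm c) = c * cnj c"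
    using complex_norm_square[of c] by (simp add: power2_eq_square)
  ultimately have cN: "c * cnj c * ?N = 1" by simp
  have "of_real (\<Sum>\<beta>\<in>UNIV. (norm (fourier f \<beta>))\<^sup>2) = (\<Sum>\<beta>\<in>UNIV. fourier f \<beta> * cnj (fourier f \<beta>))"
    by (simp add: complex_norm_square[symmetric])
  also have "\<dots> = (\<Sum>\<beta>\<in>UNIV. \<Sum>\<gamma>\<in>UNIV. \<Sum>\<gamma>'\<in>UNIV. c * cnj c * f \<gamma> * cnj (f \<gamma>') * e (bilin q \<beta> (\<gamma> - \<gamma>')))"
  proof (intro sum.cong refl)
    fix \<beta>
    have *: "e (bilin q \<gamma> \<beta>) * cnj (e (bilin q \<gamma>' \<beta>)) = e (bilin q \<beta> (\<gamma> - \<gamma>'))" for \<gamma> \<gamma>'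
      using bilin_add_right[of \<beta> "\<gamma> - \<gamma>'" \<gamma>'] bilin_sym[of \<beta>]
      by (simp add: cnj_e flip: e_add)
    have "fourier f \<beta> * cnj (fourier f \<beta>) =
        c * cnj c * (\<Sum>\<gamma>\<in>UNIV. \<Sum>\<gamma>'\<in>UNIV. (e (bilin q \<gamma> \<beta>) * f \<gamma>) * cnj (e (bilin q \<gamma>' \<beta>) * f \<gamma>'))"
      unfolding fourier_def c_def[symmetric] by (simp add: sum_product mult_ac)
    also have "\<dots> = (\<Sum>\<gamma>\<in>UNIV. \<Sum>\<gamma>'\<in>UNIV. c * cnj c * f \<gamma> * cnj (f \<gamma>') * e (bilin q \<beta> (\<gamma> - \<gamma>')))"
      unfolding *[symmetric] sum_distrib_left by (intro sum.cong refl) (simp add: mult_ac)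
    finally show "fourier f \<beta> * cnj (fourier f \<beta>) =
        (\<Sum>\<gamma>\<in>UNIV. \<Sum>\<gamma>'\<in>UNIV. c * cnj c * f \<gamma> * cnj (f \<gamma>') * e (bilin q \<beta> (\<gamma> - \<gamma>')))" .
  qed
  also have "\<dots> = (\<Sum>\<gamma>\<in>UNIV. \<Sum>\<gamma>'\<in>UNIV. \<Sum>\<beta>\<in>UNIV. c * cnj c * f \<gamma> * cnj (f \<gamma>') * e (bilin q \<beta> (\<gamma> - \<gamma>')))"
    by (rule trans[OF sum.swap]) (rule sum.cong[OF refl], rule sum.swap)
  also have "\<dots> = (\<Sum>\<gamma>\<in>UNIV. \<Sum>\<gamma>'\<in>UNIV. if \<gamma> = \<gamma>' then c * cnj c * ?N * (f \<gamma> * cnj (f \<gamma>)) else 0)"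
    by (intro sum.cong refl) (simp add: sum_e_bilin mult_ac flip: sum_distrib_left)
  also have "\<dots> = of_real (\<Sum>\<gamma>\<in>UNIV. (norm (f \<gamma>))\<^sup>2)"
    unfolding cN by (simp add: complex_norm_square[symmetric])
  finally show ?thesis by (simp only: of_real_eq_iff)
qed

text \<open>On isotropic elements the transform already has the full norm of \<open>f\<close>, so
  Parseval leaves nothing elsewhere. Thus fixed functions of the compression are fixed by the full
  transform.\<close>

lemma fourier_fixed_if_isotropic_fixed:
  assumes supp: "\<And>\<gamma>. q \<gamma> \<noteq> 0 \<Longrightarrow> f \<gamma> = 0" and eq: "\<And>\<beta>. q \<beta> = 0 \<Longrightarrow> fourier f \<beta> = f \<beta>"
  shows "fourier f \<beta> = f \<beta>"
proof (cases "q \<beta> = 0")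
  case False
  have "(\<Sum>\<beta>\<in>UNIV. (norm (fourier f \<beta>))\<^sup>2 - (norm (f \<beta>))\<^sup>2) = 0"
    by (simp add: sum_subtractf parseval)
  moreover have nonneg: "(norm (fourier f \<beta>))\<^sup>2 - (norm (f \<beta>))\<^sup>2 \<ge> 0" for \<beta>
    using supp[of \<beta>] eq[of \<beta>] by (cases "q \<beta> = 0") auto
  ultimately have "(norm (fourier f \<beta>))\<^sup>2 - (norm (f \<beta>))\<^sup>2 = 0"
    using sum_nonneg_eq_0_iff[of UNIV "\<lambda>\<beta>. (norm (fourier f \<beta>))\<^sup>2 - (norm (f \<beta>))\<^sup>2"] by simp
  then show ?thesis using supp[OF False] by simp
qed (rule eq)

subsection \<open>The projection onto the fixed functions\<close>

text \<open>The support condition expresses invariance under \<open>matT\<close>, the other one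
  invariance under \<open>matS\<close>.\<close>

definition fixed_space :: "(complex, 'd) vec set" where
  "fixed_space = {v. (\<forall>\<gamma>. q \<gamma> \<noteq> 0 \<longrightarrow> v $ \<gamma> = 0) \<and> (\<forall>\<beta>. fourier (($) v) \<beta> = v $ \<beta>)}"

text \<open>The operator \<open>(p K + 1) / (p + 1)\<close> applied after the equivariant projection
  \<open>average / (p - 1)\<close> of the isotropic part; the denominators multiply to
  \<open>p\<^sup>2 - 1\<close>.\<close>

definition projection :: "(complex, 'd) vec \<Rightarrow> (complex, 'd) vec" where
  "projection v = (\<chi> \<beta>.
     (of_nat p * isotropic_part (fourier (average (isotropic_part (($) v)))) \<beta>
       + average (isotropic_part (($) v)) \<beta>) / (of_nat p ^ 2 - 1))"

lemma p_square_minus_1_nonzero: "(of_nat p :: complex) ^ 2 - 1 \<noteq> 0"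
proof
  assume "(of_nat p :: complex) ^ 2 - 1 = 0"
  then have "(of_nat (p ^ 2) :: complex) = of_nat 1" by simp
  then have "p ^ 2 = 1" unfolding of_nat_eq_iff .
  then show False using p_gt_1 by (simp add: power2_eq_square)
qed

lemma neg_one_not_dvd: "\<not> int p dvd -1"
  using p_gt_1 by simp

lemma average_minus: "average f (- \<beta>) = \<eta> (-1) * average f \<beta>"
  using average_zmult[OF neg_one_not_dvd, of f \<beta>] by (simp add: zmult_minus)

lemma fourier_add: "fourier (\<lambda>\<gamma>. f \<gamma> + g \<gamma>) \<beta> = fourier f \<beta> + fourier g \<beta>"
  by (simp add: fourier_def distrib_left sum.distrib)

lemma fourier_cmult: "fourier (\<lambda>\<gamma>. c * f \<gamma>) \<beta> = c * fourier f \<beta>"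
  by (simp add: fourier_def sum_distrib_left mult_ac)

lemma average_add: "average (\<lambda>\<gamma>. f \<gamma> + g \<gamma>) \<beta> = average f \<beta> + average g \<beta>"
  by (simp add: average_def distrib_left sum.distrib)

lemma average_cmult: "average (\<lambda>\<gamma>. c * f \<gamma>) \<beta> = c * average f \<beta>"
  by (simp add: average_def sum_distrib_left mult_ac)

text \<open>Unit multiples of non-isotropic elements are non-isotropic, as \<open>q\<close> scales
  by the square of the unit.\<close>

lemma average_isotropic_support:
  assumes "\<And>\<gamma>. q \<gamma> \<noteq> 0 \<Longrightarrow> f \<gamma> = 0" "q \<beta> \<noteq> 0"
  shows "average f \<beta> = 0"
  unfolding average_def
proof (intro sum.neutral ballI)
  fix s assume s: "s \<in> {1..<int p}"
  have "\<not> int p dvd s\<^sup>2"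
    using unit_not_dvd[OF s] prime_p by (simp add: prime_dvd_power_iff)
  then have "q (zmult s \<beta>) \<noteq> 0"
    using assms(2) zmult_eq_0_iff[OF prime_p q_torsion] by (simp add: q_zmult)
  then show "\<eta> s * f (zmult s \<beta>) = 0" using assms(1) by simp
qed

lemma linear_projection: "Vector_Spaces.linear (*s) (*s) projection"
proof -
  have add: "isotropic_part (($) (v + w)) = (\<lambda>\<gamma>. isotropic_part (($) v) \<gamma> + isotropic_part (($) w) \<gamma>)"
    for v w by (auto simp: isotropic_part_def)
  have scale: "isotropic_part (($) (c *s v)) = (\<lambda>\<gamma>. c * isotropic_part (($) v) \<gamma>)"
    for c v by (auto simp: isotropic_part_def)
  have avg_add: "average (\<lambda>\<gamma>. f \<gamma> + g \<gamma>) = (\<lambda>\<beta>. average f \<beta> + average g \<beta>)" for f g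
    by (rule ext) (rule average_add)
  have avg_cmult: "average (\<lambda>\<gamma>. c * f \<gamma>) = (\<lambda>\<beta>. c * average f \<beta>)" for c f
    by (rule ext) (rule average_cmult)
  have iso_add: "isotropic_part (fourier (\<lambda>\<gamma>. f \<gamma> + g \<gamma>)) \<beta> =
      isotropic_part (fourier f) \<beta> + isotropic_part (fourier g) \<beta>" for f g \<beta>
    by (simp add: isotropic_part_def fourier_add)
  have iso_cmult: "isotropic_part (fourier (\<lambda>\<gamma>. c * f \<gamma>)) \<beta> = c * isotropic_part (fourier f) \<beta>" for c f \<beta>
    by (simp add: isotropic_part_def fourier_cmult)
  show ?thesis
  proof (unfold_locales)
    fix v w
    show "projection (v + w) = projection v + projection w"
      unfolding projection_def add avg_add
      by (simp add: vec_eq_iff iso_add algebra_simps add_divide_distrib)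
  next
    fix c v
    show "projection (c *s v) = c *s projection v"
      unfolding projection_def scale avg_cmult
      by (simp add: vec_eq_iff iso_cmult algebra_simps)
  qed
qed

text \<open>For fixed \<open>f\<close> the formula for the squared compression expresses
  \<open>p f(\<beta>)\<close> through \<open>f(-\<beta>)\<close> and the average. Applying it again
  at \<open>-\<beta>\<close> gives \<open>p\<^sup>2 f = f + (p + 1) average f\<close>, whence
  \<open>f\<close> is equivariant.\<close>

lemma average_fixed:
  assumes supp: "\<And>\<gamma>. q \<gamma> \<noteq> 0 \<Longrightarrow> f \<gamma> = 0" and fixed: "\<And>\<beta>. fourier f \<beta> = f \<beta>"
  shows "average f \<beta> = (of_nat p - 1) * f \<beta>"
proof (cases "q \<beta> = 0")
  case False
  then show ?thesis using average_isotropic_support[of f, OF supp] supp by simp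
next
  case True
  have "fourier f = f" "isotropic_part f = f"
    using supp fixed by (auto simp: isotropic_part_def)
  then have *: "of_nat p * f \<gamma> = \<eta> (-1) * f (- \<gamma>) + average f \<gamma>" if "q \<gamma> = 0" for \<gamma>
    using fourier_fourier_isotropic[of f, OF supp that] by simp
  have "of_nat p * (of_nat p * f \<beta>) = \<eta> (-1) * (of_nat p * f (- \<beta>)) + of_nat p * average f \<beta>"
    unfolding *[OF True] by (simp add: distrib_left mult.left_commute)
  also have "\<eta> (-1) * (of_nat p * f (- \<beta>)) = \<eta> (-1) * (\<eta> (-1) * (f \<beta> + average f \<beta>))"
    using *[of "- \<beta>"] True by (simp add: q_minus average_minus distrib_left)
  also have "\<dots> = f \<beta> + average f \<beta>" by (rule \<eta>_cancel[OF neg_one_not_dvd])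
  finally have "(of_nat p + 1) * (average f \<beta> - (of_nat p - 1) * f \<beta>) = 0"
    by (simp add: algebra_simps)
  moreover have "(of_nat p + 1 :: complex) \<noteq> 0"
    by (metis of_nat_0_eq_iff of_nat_Suc add.commute Suc_not_Zero)
  ultimately show ?thesis by simp
qed

lemma projection_fixed:
  assumes "v \<in> fixed_space"
  shows "projection v = v"
proof -
  have supp: "\<And>\<gamma>. q \<gamma> \<noteq> 0 \<Longrightarrow> v $ \<gamma> = 0" and fixed: "\<And>\<beta>. fourier (($) v) \<beta> = v $ \<beta>"
    using assms by (auto simp: fixed_space_def)
  have iso: "isotropic_part (($) v) = ($) v" using supp by (auto simp: isotropic_part_def)
  have avg: "average (($) v) = (\<lambda>\<beta>. (of_nat p - 1) * v $ \<beta>)"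
    using average_fixed[of "($) v", OF supp fixed] by blast
  have "isotropic_part (fourier (\<lambda>\<beta>. (of_nat p - 1) * v $ \<beta>)) \<beta> = (of_nat p - 1) * v $ \<beta>" for \<beta>
    using supp by (simp add: isotropic_part_def fourier_cmult fixed)
  then have "projection v $ \<beta> =
      (of_nat p * ((of_nat p - 1) * v $ \<beta>) + (of_nat p - 1) * v $ \<beta>) / (of_nat p ^ 2 - 1)" for \<beta>
    unfolding projection_def iso avg by simp
  moreover have "(of_nat p * ((of_nat p - 1) * v $ \<beta>) + (of_nat p - 1) * v $ \<beta>) / (of_nat p ^ 2 - 1) = v $ \<beta>" for \<beta>
    using p_square_minus_1_nonzero by (simp add: field_simps power2_eq_square)
  ultimately show ?thesis by (simp add: vec_eq_iff)
qed

text \<open>For the equivariant function \<open>h\<close>, the relation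
  \<open>p K\<^sup>2 h = h + (p - 1) K h\<close> shows that \<open>w = p K h + h\<close> satisfies
  \<open>K w = w\<close>; the norm argument extends this to non-isotropic elements.\<close>

lemma projection_in_fixed_space: "projection v \<in> fixed_space"
proof -
  define h where "h = average (isotropic_part (($) v))"
  define w where "w \<beta> = of_nat p * isotropic_part (fourier h) \<beta> + h \<beta>" for \<beta>
  have h_supp: "h \<gamma> = 0" if "q \<gamma> \<noteq> 0" for \<gamma>
    unfolding h_def using that by (intro average_isotropic_support) (simp_all add: isotropic_part_def)
  have h_eq: "h (zmult t \<gamma>) = \<eta> t * h \<gamma>" if "\<not> int p dvd t" for t \<gamma>
    unfolding h_def by (rule average_zmult[OF that])
  have avg: "average (fourier h) \<beta> = (of_nat p - 1) * fourier h \<beta>" for \<beta>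
    by (intro average_equivariant fourier_equivariant h_eq unit_not_dvd)
  have w_supp: "w \<gamma> = 0" if "q \<gamma> \<noteq> 0" for \<gamma>
    using that by (simp add: w_def isotropic_part_def h_supp)
  have w_isotropic: "fourier w \<beta> = w \<beta>" if \<beta>: "q \<beta> = 0" for \<beta>
  proof -
    have "fourier w \<beta> = of_nat p * fourier (isotropic_part (fourier h)) \<beta> + fourier h \<beta>"
      unfolding w_def by (simp add: fourier_add fourier_cmult)
    also have "of_nat p * fourier (isotropic_part (fourier h)) \<beta> = \<eta> (-1) * h (- \<beta>) + average (fourier h) \<beta>"
      by (rule fourier_fourier_isotropic[OF h_supp \<beta>])
    also have "\<eta> (-1) * h (- \<beta>) = h \<beta>"
      using h_eq[OF neg_one_not_dvd, of \<beta>] \<eta>_cancel[OF neg_one_not_dvd] by (simp add: zmult_minus)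
    also have "h \<beta> + average (fourier h) \<beta> + fourier h \<beta> = w \<beta>"
      using \<beta> by (simp add: avg w_def isotropic_part_def algebra_simps)
    finally show ?thesis .
  qed
  have w_fixed: "fourier w \<beta> = w \<beta>" for \<beta>
    by (rule fourier_fixed_if_isotropic_fixed[OF w_supp w_isotropic])
  have proj: "projection v $ \<beta> = inverse (of_nat p ^ 2 - 1) * w \<beta>" for \<beta>
    by (simp add: projection_def w_def h_def divide_inverse mult.commute)
  then have "($) (projection v) = (\<lambda>\<beta>. inverse (of_nat p ^ 2 - 1) * w \<beta>)" by auto
  then show ?thesis
    unfolding fixed_space_def by (simp add: fourier_cmult w_fixed w_supp)
qed

text \<open>Delta functions make these the diagonal entries. The unit 1 fixes every isotropic
  element, while any other \<open>s\<close> fixes only 0 and contributes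
  \<open>\<eta> s\<close>.\<close>

lemma trace_average:
  "(\<Sum>\<gamma>\<in>{\<gamma>. q \<gamma> = 0}. average (\<lambda>x. if x = \<gamma> then 1 else 0) \<gamma>) =
    of_nat (card {\<gamma>. q \<gamma> = 0}) + (\<Sum>s\<in>{1..<int p}. \<eta> s) - 1"
proof -
  let ?X = "{\<gamma>. q \<gamma> = 0}"
  have I: "{1..<int p} = insert 1 {2..<int p}" using p_gt_1 by auto
  have fixed_points: "(\<Sum>\<gamma>\<in>?X. if zmult s \<gamma> = \<gamma> then 1 else 0) = (1::complex)" if s: "s \<in> {2..<int p}" for s
  proof -
    have "\<not> int p dvd s - 1" using s by (intro unit_not_dvd) simp
    then have "zmult s \<gamma> = \<gamma> \<longleftrightarrow> \<gamma> = 0" for \<gamma> :: 'd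
      using zmult_eq_0_iff[OF prime_p torsion, of "s - 1" \<gamma>] by (simp add: zmult_diff_one)
    then show ?thesis by (simp add: sum.delta)
  qed
  have "(\<Sum>\<gamma>\<in>?X. average (\<lambda>x. if x = \<gamma> then 1 else 0) \<gamma>) =
      (\<Sum>s\<in>{1..<int p}. \<eta> s * (\<Sum>\<gamma>\<in>?X. if zmult s \<gamma> = \<gamma> then 1 else 0))"
    unfolding average_def sum_distrib_left by (rule sum.swap)
  also have "\<dots> = of_nat (card ?X) + (\<Sum>s\<in>{2..<int p}. \<eta> s)"
    unfolding I using fixed_points by (simp add: \<eta>_1)
  also have "(\<Sum>s\<in>{2..<int p}. \<eta> s) = (\<Sum>s\<in>{1..<int p}. \<eta> s) - 1"
    unfolding I by (simp add: \<eta>_1)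
  finally show ?thesis by simp
qed

text \<open>The deltas select \<open>\<gamma> = zmult s \<alpha>\<close>, where the phase is trivial
  because \<open>bilin q \<alpha> \<alpha>\<close> is twice \<open>q \<alpha> = 0\<close>. Each
  isotropic \<open>\<alpha>\<close> thus contributes once for every \<open>s\<close>.\<close>

lemma trace_fourier_average:
  "(\<Sum>\<gamma>\<in>{\<gamma>. q \<gamma> = 0}. fourier (average (\<lambda>x. if x = \<gamma> then 1 else 0)) \<gamma>) =
    G / of_nat CARD('d) * of_nat (card {\<gamma>. q \<gamma> = 0}) * (\<Sum>s\<in>{1..<int p}. \<eta> s)"
proof -
  let ?X = "{\<gamma>. q \<gamma> = 0}" and ?c = "G / of_nat CARD('d)"
  have inner: "(\<Sum>\<gamma>\<in>?X. e (bilin q \<alpha> \<gamma>) * (if zmult s \<alpha> = \<gamma> then 1 else 0)) = (if q \<alpha> = 0 then 1 else 0)"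
    if s: "s \<in> {1..<int p}" for s \<alpha>
  proof -
    have "\<not> int p dvd s\<^sup>2"
      using unit_not_dvd[OF s] prime_p by (simp add: prime_dvd_power_iff)
    then have "q (zmult s \<alpha>) = 0 \<longleftrightarrow> q \<alpha> = 0"
      using zmult_eq_0_iff[OF prime_p q_torsion] by (simp add: q_zmult)
    moreover have "bilin q \<alpha> (zmult s \<alpha>) = 0" if "q \<alpha> = 0"
      using that by (simp add: bilin_zmult_right bilin_self)
    ultimately show ?thesis by (simp add: if_distrib[of "\<lambda>x. _ * x"] cong: if_cong)
  qed
  have "(\<Sum>\<gamma>\<in>?X. fourier (average (\<lambda>x. if x = \<gamma> then 1 else 0)) \<gamma>) =
      (\<Sum>\<gamma>\<in>?X. \<Sum>\<alpha>\<in>UNIV. \<Sum>s\<in>{1..<int p}.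
        ?c * \<eta> s * (e (bilin q \<alpha> \<gamma>) * (if zmult s \<alpha> = \<gamma> then 1 else 0)))"
    unfolding fourier_def average_def sum_distrib_left by (simp only: mult_ac)
  also have "\<dots> = (\<Sum>\<alpha>\<in>UNIV. \<Sum>\<gamma>\<in>?X. \<Sum>s\<in>{1..<int p}.
        ?c * \<eta> s * (e (bilin q \<alpha> \<gamma>) * (if zmult s \<alpha> = \<gamma> then 1 else 0)))"
    by (rule sum.swap)
  also have "\<dots> = (\<Sum>\<alpha>\<in>UNIV. \<Sum>s\<in>{1..<int p}. \<Sum>\<gamma>\<in>?X.
        ?c * \<eta> s * (e (bilin q \<alpha> \<gamma>) * (if zmult s \<alpha> = \<gamma> then 1 else 0)))"
    by (rule sum.cong[OF refl], rule sum.swap)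
  also have "\<dots> = (\<Sum>\<alpha>\<in>UNIV. \<Sum>s\<in>{1..<int p}. ?c * \<eta> s * (if q \<alpha> = 0 then 1 else 0))"
    unfolding sum_distrib_left[symmetric] by (intro sum.cong refl arg_cong2[where f = "(*)"] inner)
  also have "\<dots> = (\<Sum>\<alpha>\<in>UNIV. (if q \<alpha> = 0 then 1 else 0) * (?c * (\<Sum>s\<in>{1..<int p}. \<eta> s)))"
    by (simp add: sum_distrib_left mult_ac)
  also have "\<dots> = (\<Sum>\<alpha>\<in>UNIV. if q \<alpha> = 0 then 1 else 0) * (?c * (\<Sum>s\<in>{1..<int p}. \<eta> s))"
    by (rule sum_distrib_right[symmetric])
  also have "(\<Sum>\<alpha>\<in>UNIV. if q \<alpha> = 0 then 1 else 0) = (of_nat (card ?X) :: complex)"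
    by (simp add: sum.If_cases)
  finally show ?thesis by (simp add: mult_ac)
qed

text \<open>The trace of \<open>projection\<close> in the standard basis, to which only isotropic
  basis vectors contribute.\<close>

theorem dim_fixed_space:
  "of_nat (vec.dim fixed_space) * (of_nat p ^ 2 - 1) =
    of_nat p * (G / of_nat CARD('d) * of_nat (card {\<gamma>. q \<gamma> = 0}) * (\<Sum>s\<in>{1..<int p}. \<eta> s))
    + of_nat (card {\<gamma>. q \<gamma> = 0}) + (\<Sum>s\<in>{1..<int p}. \<eta> s) - 1"
proof -
  let ?X = "{\<gamma>. q \<gamma> = 0}" and ?r = "of_nat p ^ 2 - 1 :: complex"
  let ?\<delta> = "\<lambda>\<gamma> x. if x = \<gamma> then 1 else 0 :: complex"
  have iso: "isotropic_part (($) (axis \<gamma> 1)) = (if q \<gamma> = 0 then ?\<delta> \<gamma> else (\<lambda>_. 0))" for \<gamma>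
    by (auto simp: isotropic_part_def axis_def)
  have zero: "average (\<lambda>_. 0) = (\<lambda>_. 0)" by (auto simp: average_def)
  have "of_nat (vec.dim fixed_space) = (\<Sum>\<gamma>\<in>UNIV. projection (axis \<gamma> 1) $ \<gamma>)"
    by (rule trace_idempotent_eq_dim[symmetric])
       (simp_all add: linear_projection projection_fixed projection_in_fixed_space)
  also have "\<dots> = (\<Sum>\<gamma>\<in>UNIV. if q \<gamma> = 0 then
      (of_nat p * fourier (average (?\<delta> \<gamma>)) \<gamma> + average (?\<delta> \<gamma>) \<gamma>) / ?r else 0)"
    by (intro sum.cong refl) (simp add: projection_def iso zero isotropic_part_def[of "fourier _"])
  also have "\<dots> = (\<Sum>\<gamma>\<in>?X. (of_nat p * fourier (average (?\<delta> \<gamma>)) \<gamma> + average (?\<delta> \<gamma>) \<gamma>) / ?r)"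
    by (simp add: sum.If_cases)
  also have "\<dots> = (of_nat p * (\<Sum>\<gamma>\<in>?X. fourier (average (?\<delta> \<gamma>)) \<gamma>) + (\<Sum>\<gamma>\<in>?X. average (?\<delta> \<gamma>) \<gamma>)) / ?r"
    by (simp only: sum_divide_distrib[symmetric] sum.distrib sum_distrib_left)
  finally show ?thesis
    using p_square_minus_1_nonzero by (simp add: trace_average trace_fourier_average field_simps)
qed

end

subsection \<open>Discriminant forms of prime exponent\<close>

text \<open>Translation by the generator permutes the cyclic group; compare the sums of its elements.\<close>

lemma cyclic_span_torsion:
  fixes g :: "'a::{finite,ab_group_add}"
  shows "zmult (int (card (cyclic_span g))) g = 0"
proof -
  let ?H = "cyclic_span g"
  have "(\<Sum>h\<in>?H. h) = (\<Sum>h\<in>?H. h + g)"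
  proof (rule sum.reindex_bij_witness[of _ "\<lambda>h. h + g" "\<lambda>h. h - g"])
    show "h - g \<in> ?H" if "h \<in> ?H" for h
      using that unfolding cyclic_span_def by (metis (no_types, lifting) imageE rangeI zmult_diff_one)
    show "h + g \<in> ?H" if "h \<in> ?H" for h
      using that unfolding cyclic_span_def by (metis (no_types, lifting) imageE rangeI zmult_add_one)
  qed auto
  then show ?thesis by (simp add: sum.distrib sum_constant_zmult)
qed

text \<open>Torsion gives surjectivity; equal cardinality then gives injectivity.\<close>

lemma bij_betw_cyclic_span:
  fixes g :: "'a::{finite,ab_group_add}"
  assumes "card (cyclic_span g) = p" "p > 0"
  shows "bij_betw (\<lambda>k. zmult k g) {0..<int p} (cyclic_span g)"
proof -
  have tor: "zmult (int p) g = 0" using cyclic_span_torsion[of g] assms by simp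
  have "(\<lambda>k. zmult k g) ` {0..<int p} = cyclic_span g"
  proof (intro equalityI subsetI)
    fix x assume "x \<in> cyclic_span g"
    then obtain k where "x = zmult k g" by (auto simp: cyclic_span_def)
    then have "x = zmult (k mod int p) g" by (simp add: zmult_mod tor)
    then show "x \<in> (\<lambda>k. zmult k g) ` {0..<int p}" using assms(2) by auto
  qed (auto simp: cyclic_span_def)
  moreover from this have "inj_on (\<lambda>k. zmult k g) {0..<int p}"
    using assms(1) by (intro eq_card_imp_inj_on) simp_all
  ultimately show ?thesis by (simp add: bij_betw_def)
qed

lemma q_sum_orthogonal:
  assumes "discriminant_form q" "finite A"
    and "\<And>i j. i \<in> A \<Longrightarrow> j \<in> A \<Longrightarrow> i \<noteq> j \<Longrightarrow> bilin q (x i) (x j) = 0"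
  shows "q (\<Sum>i\<in>A. x i) = (\<Sum>i\<in>A. q (x i))"
proof -
  have add: "bilin q \<alpha> (\<beta> + \<gamma>) = bilin q \<alpha> \<beta> + bilin q \<alpha> \<gamma>" for \<alpha> \<beta> \<gamma>
    using assms(1) by (simp add: discriminant_form_def quadratic_form_def)
  have zero: "bilin q \<alpha> 0 = 0" for \<alpha> using add[of \<alpha> 0 0] by simp
  have q0: "q 0 = 0" using zero[of 0] by (simp add: bilin_def)
  have sum: "bilin q \<alpha> (\<Sum>i\<in>B. x i) = (\<Sum>i\<in>B. bilin q \<alpha> (x i))" for \<alpha> B
    by (induction B rule: infinite_finite_induct) (simp_all add: zero add)
  from assms(2,3) show ?thesis
  proof (induction A)
    case (insert i B)
    have "bilin q (x i) (\<Sum>j\<in>B. x j) = 0"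
      unfolding sum using insert by (intro sum.neutral) auto
    then have "q (x i + (\<Sum>j\<in>B. x j)) = q (x i) + q (\<Sum>j\<in>B. x j)"
      by (simp add: bilin_def algebra_simps)
    then show ?case using insert by simp
  qed (simp add: q0)
qed

text \<open>The definite description is meaningful only if Milgram's formula has exactly one
  solution. The hypothesis makes the normalised Gauss sum a fourth root of unity, which yields an
  even solution; faithfulness of \<open>e\<close> gives uniqueness modulo 8.\<close>

lemma signature_eq:
  fixes q :: "'d::{finite,ab_group_add} \<Rightarrow> rat_mod_int"
  assumes "(\<Sum>\<gamma>\<in>UNIV. e (q \<gamma>)) ^ 4 = of_nat CARD('d) ^ 2"
  shows "(\<Sum>\<gamma>\<in>UNIV. e (q \<gamma>)) =
    of_real (sqrt (real CARD('d))) * e (rat_class (of_int (signature q) / 8))"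
proof -
  let ?G = "\<Sum>\<gamma>\<in>UNIV. e (q \<gamma>)" and ?r = "of_real (sqrt (real CARD('d))) :: complex"
  let ?P = "\<lambda>s. s \<in> {0..<8} \<and> ?G = ?r * e (rat_class (of_int s / 8))"
  \<comment> \<open>This is the imaginary unit, so its powers run through all fourth roots of
    unity.\<close>
  define w where "w = e (rat_class (of_int 2 / 8))"
  have e8: "e (rat_class (of_int k / 8)) = 1 \<longleftrightarrow> 8 dvd k" for k
    using rat_class_divide_eq_0_iff[of 8 k] by (simp add: e_eq_1_iff)
  have w_pow: "w ^ j = e (rat_class (of_int (2 * int j) / 8))" for j
    by (simp add: w_def zmult_rat_class mult.commute flip: e_zmult_nat)
  have "w ^ 4 = 1" "w ^ 2 \<noteq> 1" unfolding w_pow e8 by simp_all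
  then have w2: "w ^ 2 = -1"
    using power2_eq_1_iff[of "w ^ 2"] by (simp flip: power_mult)
  have r2: "?r ^ 2 = of_nat CARD('d)" by (simp flip: of_real_power)
  have r0: "?r \<noteq> 0" by simp
  define z where "z = ?G / ?r"
  have "z ^ 4 = ?G ^ 4 / (?r ^ 2) ^ 2" by (simp add: z_def power_divide flip: power_mult)
  also have "\<dots> = 1" unfolding r2 using assms by simp
  finally have "(z ^ 2) ^ 2 = 1" by (simp flip: power_mult)
  then consider "z ^ 2 = 1" | "z ^ 2 = w ^ 2"
    using power2_eq_1_iff[of "z ^ 2"] w2 by auto
  then have "\<exists>j<4. z = w ^ j"
  proof cases
    case 1
    then have "z = w ^ 0 \<or> z = w ^ 2" using power2_eq_1_iff[of z] w2 by auto
    then show ?thesis using exI[of "\<lambda>j. j < 4 \<and> z = w ^ j" 0] exI[of "\<lambda>j. j < 4 \<and> z = w ^ j" 2] by auto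
  next
    case 2
    then have "z = w \<or> z = - w" by (simp add: power2_eq_iff)
    moreover have "w ^ 3 = - w" using w2 by (simp add: numeral_3_eq_3 power2_eq_square)
    ultimately have "z = w ^ 1 \<or> z = w ^ 3" by simp
    then show ?thesis using exI[of "\<lambda>j. j < 4 \<and> z = w ^ j" 1] exI[of "\<lambda>j. j < 4 \<and> z = w ^ j" 3] by auto
  qed
  then obtain j where j: "j < 4" "z = w ^ j" by blast
  then have "?G = ?r * e (rat_class (of_int (2 * int j) / 8))"
    using r0 w_pow[of j] by (simp add: z_def field_simps)
  with j have ex: "?P (2 * int j)" by simp
  have uniq: "s = s'" if "?P s" "?P s'" for s s'
  proof -
    have eq: "e (rat_class (of_int s / 8)) = e (rat_class (of_int s' / 8))"
      using that r0 by (metis mult_left_cancel)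
    have "rat_class (of_int s / 8) = rat_class (of_int (s - s') / 8) + rat_class (of_int s' / 8)"
      by (simp add: plus_rat_mod_int.abs_eq diff_divide_distrib)
    then have "e (rat_class (of_int (s - s') / 8)) = 1"
      using eq e_add[of "rat_class (of_int (s - s') / 8)" "rat_class (of_int s' / 8)"] by simp
    then have "8 dvd s - s'" by (simp only: e8)
    then have "s mod 8 = s' mod 8" by (simp add: mod_eq_dvd_iff)
    then show ?thesis using that by simp
  qed
  have "?P (signature q)"
    unfolding signature_def by (rule theI[of ?P, OF ex uniq[OF _ ex]])
  then show ?thesis by blast
qed

text \<open>The stabiliser of a vector is closed under products and, since each
  \<open>\<rho> M\<close> has a left inverse, under left cancellation.\<close>

lemma invariants_eq_fixed_by_generators:
  assumes "weil_representation q \<rho>"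
  shows "invariants \<rho> = {v. \<rho> matS v = v \<and> \<rho> matT v = v}"
proof (intro equalityI subsetI)
  have gens: "matS \<in> SL2Z" "matT \<in> SL2Z" by (simp_all add: matS_def matT_def SL2Z_2x2_iff)
  show "v \<in> {v. \<rho> matS v = v \<and> \<rho> matT v = v}" if "v \<in> invariants \<rho>" for v
    using that gens by (auto simp: invariants_def)
next
  fix v assume "v \<in> {v. \<rho> matS v = v \<and> \<rho> matT v = v}"
  then have v: "\<rho> matS v = v" "\<rho> matT v = v" by auto
  have one: "\<rho> (mat 1) = id" and comp: "\<And>M N. M \<in> SL2Z \<Longrightarrow> N \<in> SL2Z \<Longrightarrow> \<rho> (M ** N) = \<rho> M \<circ> \<rho> N"
    using assms by (auto simp: weil_representation_def)
  \<comment> \<open>The inverse is the adjugate matrix.\<close>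
  have inverse: "\<exists>N\<in>SL2Z. N ** M = mat 1" if "M \<in> SL2Z" for M
  proof
    let ?N = "vector [vector [M $ 2 $ 2, - M $ 1 $ 2], vector [- M $ 2 $ 1, M $ 1 $ 1]] :: int^2^2"
    have det: "M $ 1 $ 1 * M $ 2 $ 2 - M $ 1 $ 2 * M $ 2 $ 1 = 1"
      using that by (simp add: SL2Z_def det_2)
    then show "?N \<in> SL2Z" by (simp add: SL2Z_2x2_iff mult.commute)
    show "?N ** M = mat 1"
      using det by (simp add: vec_eq_iff forall_2 matrix_matrix_mult_def sum_2 vector_2 mat_def mult.commute)
  qed
  have "SL2Z \<subseteq> {M. \<rho> M v = v}"
  proof (rule SL2Z_subset_if_generators)
    fix M N assume M: "M \<in> SL2Z" "N \<in> SL2Z" "M \<in> {M. \<rho> M v = v}" "M ** N \<in> {M. \<rho> M v = v}"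
    obtain L where L: "L \<in> SL2Z" "L ** M = mat 1" using inverse[OF M(1)] by blast
    have inv: "\<rho> L (\<rho> M u) = u" for u
      using comp[OF L(1) M(1)] L(2) one by (metis comp_apply id_apply)
    have "\<rho> M (\<rho> N v) = \<rho> M v" using M comp by simp
    then have "\<rho> L (\<rho> M (\<rho> N v)) = \<rho> L (\<rho> M v)" by simp
    then show "N \<in> {M. \<rho> M v = v}" by (simp add: inv)
  qed (use v comp in auto)
  then show "v \<in> invariants \<rho>" by (auto simp: invariants_def)
qed

text \<open>\<open>matT\<close> is diagonal with entry 1 exactly at isotropic elements. For
  \<open>matS\<close>, \<open>G_square\<close> gives the fourth-power identity required by
  \<open>signature_eq\<close>, which identifies its constant with that of
  \<open>fourier\<close>.\<close>

lemma (in elementary_form) invariants_eq_fixed_space: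
  assumes weil: "weil_representation q \<rho>" and G: "G = (\<Sum>\<gamma>\<in>UNIV. e (q \<gamma>))"
  shows "invariants \<rho> = fixed_space"
proof -
  let ?r = "of_real (sqrt (real CARD('d))) :: complex"
  have r2: "?r * ?r = of_nat CARD('d)" by (simp flip: of_real_mult)
  have "G ^ 4 = (G * G) * (G * G)" by (simp add: power4_eq_xxxx)
  also have "\<dots> = of_nat CARD('d) ^ 2"
    unfolding G_square using \<eta>_neg_square by (simp add: power2_eq_square mult_ac)
  finally have "G = ?r * e (rat_class (of_int (signature q) / 8))"
    unfolding G by (rule signature_eq)
  then have c: "e (rat_class (of_int (signature q) / 8)) / ?r = G / of_nat CARD('d)"
    using r2[symmetric] by (simp add: field_simps)
  have "Vector_Spaces.linear (*s) (*s) (\<rho> matS)" "Vector_Spaces.linear (*s) (*s) (\<rho> matT)"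
    using weil by (auto simp: weil_representation_def matS_def matT_def SL2Z_2x2_iff)
  then interpret S: Vector_Spaces.linear "(*s)" "(*s)" "\<rho> matS" + T: Vector_Spaces.linear "(*s)" "(*s)" "\<rho> matT" .
  have S_axis: "\<rho> matS (axis \<gamma> 1) = (G / of_nat CARD('d)) *s (\<Sum>\<beta>\<in>UNIV. e (bilin q \<gamma> \<beta>) *s axis \<beta> 1)" for \<gamma>
    using weil c by (simp add: weil_representation_def)
  have T_axis: "\<rho> matT (axis \<gamma> 1) = e (- q \<gamma>) *s axis \<gamma> 1" for \<gamma>
    using weil by (simp add: weil_representation_def)
  have S_axis_nth: "\<rho> matS (axis \<gamma> 1) $ \<beta> = G / of_nat CARD('d) * e (bilin q \<gamma> \<beta>)" for \<gamma> \<beta>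
    unfolding S_axis by (simp add: axis_def if_distrib[of "\<lambda>x. _ * x"] cong: if_cong)
  have T_axis_nth: "\<rho> matT (axis \<gamma> 1) $ \<beta> = (if \<gamma> = \<beta> then e (- q \<beta>) else 0)" for \<gamma> \<beta>
    unfolding T_axis by (simp add: axis_def)
  have S: "\<rho> matS v $ \<beta> = fourier (($) v) \<beta>" for v \<beta>
  proof -
    have "\<rho> matS v = \<rho> matS (\<Sum>\<gamma>\<in>UNIV. v $ \<gamma> *s axis \<gamma> 1)" by (simp add: basis_expansion)
    also have "\<dots> = (\<Sum>\<gamma>\<in>UNIV. v $ \<gamma> *s \<rho> matS (axis \<gamma> 1))" by (simp add: S.sum S.scale)
    finally have "\<rho> matS v $ \<beta> = (\<Sum>\<gamma>\<in>UNIV. v $ \<gamma> * (G / of_nat CARD('d) * e (bilin q \<gamma> \<beta>)))"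
      by (simp add: S_axis_nth)
    then show ?thesis by (simp add: fourier_def sum_distrib_left mult_ac)
  qed
  have T: "\<rho> matT v $ \<beta> = e (- q \<beta>) * v $ \<beta>" for v \<beta>
  proof -
    have "\<rho> matT v = \<rho> matT (\<Sum>\<gamma>\<in>UNIV. v $ \<gamma> *s axis \<gamma> 1)" by (simp add: basis_expansion)
    also have "\<dots> = (\<Sum>\<gamma>\<in>UNIV. v $ \<gamma> *s \<rho> matT (axis \<gamma> 1))" by (simp add: T.sum T.scale)
    finally show ?thesis
      by (simp add: T_axis_nth if_distrib[of "\<lambda>x. _ * x"] mult.commute cong: if_cong)
  qed
  have "e (- q \<gamma>) * x = x \<longleftrightarrow> (q \<gamma> \<noteq> 0 \<longrightarrow> x = 0)" for \<gamma> x
    by (auto simp: e_eq_1_iff)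
  then show ?thesis
    unfolding invariants_eq_fixed_by_generators[OF weil] fixed_space_def
    by (auto simp: vec_eq_iff S T)
qed

text \<open>Orthogonality makes \<open>q\<close> additive across the cyclic summands, so the sum
  over the group factors into one Gauss sum per generator.\<close>

lemma has_type_imp_gauss_sum:
  fixes q :: "'d::{finite,ab_group_add} \<Rightarrow> rat_mod_int"
  assumes "prime p" "odd p" "discriminant_form q" "has_type q p \<epsilon> n"
  obtains a :: "nat \<Rightarrow> int" where
    "\<And>i. i < n \<Longrightarrow> \<not> int p dvd a i"
    "\<epsilon> = (\<Prod>i<n. Legendre (2 * a i) (int p))"
    "CARD('d) = p ^ n"
    "\<And>x :: 'd. zmult (int p) x = 0"
    "\<And>t. (\<Sum>\<gamma>\<in>UNIV. e (zmult t (q \<gamma>))) = (\<Prod>i<n. gauss_sum p (t * a i))"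
proof -
  have p: "p > 0" using assms(1) by (rule prime_gt_0_nat)
  from assms(4) obtain g :: "nat \<Rightarrow> 'd" and a :: "nat \<Rightarrow> int" where
    g: "\<And>i. i < n \<Longrightarrow> card (cyclic_span (g i)) = p"
    and a: "\<And>i. i < n \<Longrightarrow> \<not> int p dvd a i"
    and qg: "\<And>i. i < n \<Longrightarrow> q (g i) = rat_class (of_int (a i) / of_nat p)"
    and orth: "\<And>i j x y. i < n \<Longrightarrow> j < n \<Longrightarrow> i \<noteq> j \<Longrightarrow> x \<in> cyclic_span (g i) \<Longrightarrow>
        y \<in> cyclic_span (g j) \<Longrightarrow> bilin q x y = 0"
    and bij: "bij_betw (\<lambda>x. \<Sum>i<n. x i) (\<Pi>\<^sub>E i\<in>{..<n}. cyclic_span (g i)) UNIV"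
    and \<epsilon>: "\<epsilon> = (\<Prod>i<n. Legendre (2 * a i) (int p))"
    unfolding has_type_def by blast
  have q_zmult: "q (zmult k \<gamma>) = zmult (k\<^sup>2) (q \<gamma>)" for k \<gamma>
    using assms(3) by (simp add: discriminant_form_def quadratic_form_def)
  have card: "CARD('d) = p ^ n"
    using bij_betw_same_card[OF bij] g by (simp add: card_PiE)
  have torsion: "zmult (int p) x = 0" for x :: 'd
  proof -
    obtain y where y: "y \<in> (\<Pi>\<^sub>E i\<in>{..<n}. cyclic_span (g i))" "x = (\<Sum>i<n. y i)"
      using bij unfolding bij_betw_def by (metis (no_types, lifting) UNIV_I imageE)
    have "zmult (int p) (y i) = 0" if i: "i < n" for i
    proof -
      obtain k where "y i = zmult k (g i)" using y(1) i by (auto simp: cyclic_span_def PiE_iff)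
      then have "zmult (int p) (y i) = zmult k (zmult (int p) (g i))"
        by (simp add: mult.commute flip: zmult_mult)
      then show ?thesis using cyclic_span_torsion[of "g i"] g[OF i] by simp
    qed
    then show ?thesis unfolding y(2) zmult_sum by simp
  qed
  have gauss: "(\<Sum>\<gamma>\<in>UNIV. e (zmult t (q \<gamma>))) = (\<Prod>i<n. gauss_sum p (t * a i))" for t
  proof -
    have "(\<Sum>\<gamma>\<in>UNIV. e (zmult t (q \<gamma>))) =
        (\<Sum>x\<in>(\<Pi>\<^sub>E i\<in>{..<n}. cyclic_span (g i)). e (zmult t (q (\<Sum>i<n. x i))))"
      by (rule sum.reindex_bij_betw[OF bij, symmetric])
    also have "\<dots> = (\<Sum>x\<in>(\<Pi>\<^sub>E i\<in>{..<n}. cyclic_span (g i)). \<Prod>i<n. e (zmult t (q (x i))))"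
    proof (rule sum.cong[OF refl])
      fix x assume "x \<in> (\<Pi>\<^sub>E i\<in>{..<n}. cyclic_span (g i))"
      then have "q (\<Sum>i<n. x i) = (\<Sum>i<n. q (x i))"
        using orth by (intro q_sum_orthogonal[OF assms(3)]) (auto simp: PiE_iff)
      then show "e (zmult t (q (\<Sum>i<n. x i))) = (\<Prod>i<n. e (zmult t (q (x i))))"
        by (simp add: zmult_sum e_sum)
    qed
    also have "\<dots> = (\<Prod>i<n. \<Sum>y\<in>cyclic_span (g i). e (zmult t (q y)))"
      by (rule prod_sum_PiE[symmetric]) auto
    also have "\<dots> = (\<Prod>i<n. gauss_sum p (t * a i))"
    proof (rule prod.cong[OF refl])
      fix i assume "i \<in> {..<n}"
      then have i: "i < n" by simp
      have "(\<Sum>y\<in>cyclic_span (g i). e (zmult t (q y))) = (\<Sum>k\<in>{0..<int p}. e (zmult t (q (zmult k (g i)))))"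
        by (rule sum.reindex_bij_betw[OF bij_betw_cyclic_span[OF g[OF i] p], symmetric])
      also have "\<dots> = gauss_sum p (t * a i)"
        unfolding gauss_sum_def[OF assms(1,2)] root_char_def[OF assms(1,2)]
        by (simp add: q_zmult qg[OF i] zmult_rat_class mult_ac)
      finally show "(\<Sum>y\<in>cyclic_span (g i). e (zmult t (q y))) = gauss_sum p (t * a i)" .
    qed
    finally show ?thesis .
  qed
  show ?thesis by (rule that[OF a \<epsilon> card torsion gauss])
qed

text \<open>It remains to evaluate the trace formula. For odd \<open>n\<close>,
  \<open>\<eta>\<close> is the Legendre symbol on units and sums to 0; for even \<open>n\<close> it
  is 1 there and sums to \<open>p - 1\<close>, and \<open>G\<close> is a sign times
  \<open>p ^ (n div 2)\<close>.\<close>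

theorem theorem4p3:
  fixes p n :: nat
    and \<epsilon> :: int
    and q :: "'d::{finite,ab_group_add} \<Rightarrow> rat_mod_int"
    and \<rho> :: "int^2^2 \<Rightarrow> (complex, 'd) vec \<Rightarrow> (complex, 'd) vec"
  assumes "prime p" and "odd p"
    and "discriminant_form q"
    and "has_type q p \<epsilon> n"
    and "weil_representation q \<rho>"
  shows "(even n \<longrightarrow>
            real (vec.dim (invariants \<rho>)) =
              (real p powi (int n - 1) - real p) / (real p ^ 2 - 1)
              + of_int \<epsilon> * of_int (Legendre (-1) (int p)) ^ (n div 2)
                * real p powi ((int n - 2) div 2)
              + 1)
       \<and> (odd n \<longrightarrow>
            real (vec.dim (invariants \<rho>)) = (real p ^ (n - 1) - 1) / (real p ^ 2 - 1))"
proof -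
  note p_odd_prime = assms(1,2)
  note p2 = p_gt_2[OF p_odd_prime]
  let ?L = "\<lambda>t. Legendre t (int p)"
  obtain a where a: "\<And>i. i < n \<Longrightarrow> \<not> int p dvd a i"
    and \<epsilon>: "\<epsilon> = (\<Prod>i<n. ?L (2 * a i))"
    and card: "CARD('d) = p ^ n"
    and torsion: "\<And>x :: 'd. zmult (int p) x = 0"
    and sums: "\<And>t. (\<Sum>\<gamma>\<in>UNIV. e (zmult t (q \<gamma>))) = (\<Prod>i<n. gauss_sum p (t * a i))"
    using has_type_imp_gauss_sum[OF assms(1-4)] by blast
  \<comment> \<open>This is \<open>\<epsilon>\<close> without the factors
    \<open>?L 2\<close>.\<close>
  define A where "A = (\<Prod>i<n. ?L (a i))"
  define G where "G = (\<Prod>i<n. gauss_sum p (a i))"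
  define \<eta> where "\<eta> t = complex_of_int (?L t) ^ n" for t
  define g where "g = gauss_sum p 1"
  have g2: "g * g = of_int (?L (-1)) * of_nat p"
    using gauss_sum_square[OF p_odd_prime] by (simp add: g_def power2_eq_square)
  have G: "G = of_int A * g ^ n"
    by (simp add: G_def A_def g_def gauss_sum_eq_Legendre[OF p_odd_prime] a prod.distrib)
  have AA: "A * A = 1"
    unfolding A_def prod.distrib[symmetric]
    by (rule prod.neutral) (use Legendre_square[OF p_odd_prime] a in auto)
  have GG: "G * G = \<eta> (-1) * of_nat CARD('d)"
  proof -
    have "G * G = of_int (A * A) * (g * g) ^ n" by (simp add: G power_mult_distrib mult_ac)
    then show ?thesis by (simp add: AA g2 \<eta>_def card power_mult_distrib)
  qed
  have gauss: "(\<Sum>\<gamma>\<in>UNIV. e (zmult t (q \<gamma>))) = \<eta> t * G" if "\<not> int p dvd t" for t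
  proof -
    have "\<not> int p dvd t * a i" if "i < n" for i
      using a[OF that] \<open>\<not> int p dvd t\<close> assms(1) by (simp add: prime_dvd_mult_iff)
    then have "(\<Prod>i<n. gauss_sum p (t * a i)) = (\<Prod>i<n. of_int (?L t) * gauss_sum p (a i))"
      by (intro prod.cong refl)
         (simp add: gauss_sum_eq_Legendre[OF p_odd_prime] a Legendre_mult[OF p_odd_prime])
    then show ?thesis by (simp add: sums prod.distrib \<eta>_def G_def)
  qed
  interpret elementary_form q p \<eta> G
  proof
    show "\<eta> s * \<eta> s = 1" if "\<not> int p dvd s" for s
    proof -
      have "\<eta> s * \<eta> s = of_int (?L s * ?L s) ^ n" by (simp add: \<eta>_def power_mult_distrib)
      then show ?thesis by (simp add: Legendre_square[OF p_odd_prime that])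
    qed
  qed (use assms(1-3) torsion gauss GG in
      \<open>simp_all add: \<eta>_def Legendre_mult[OF p_odd_prime] Legendre_mod[OF p_odd_prime] power_mult_distrib\<close>)
  have "G = (\<Sum>\<gamma>\<in>UNIV. e (q \<gamma>))" using sums[of 1] by (simp add: G_def)
  then have inv: "invariants \<rho> = fixed_space" by (rule invariants_eq_fixed_space[OF assms(5)])
  define d where "d = real (vec.dim (invariants \<rho>))"
  define N where "N = real (card {\<gamma>. q \<gamma> = 0})"
  define P where "P = real p"
  have P: "P > 2" using p2 by (simp add: P_def)
  then have P0: "P \<noteq> 0" "P\<^sup>2 - 1 \<noteq> 0"
    using power2_eq_1_iff[of P] by auto
  have units: "{0..<int p} = insert 0 {1..<int p}" by (rule residues_eq_insert)
  show ?thesis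
  proof (intro conjI impI)
    assume "odd n"
    then obtain m where m: "n = 2 * m + 1" by (rule oddE)
    have "\<eta> t = of_int (?L t)" if "t \<in> {1..<int p}" for t
    proof -
      have "\<eta> t = of_int (?L t * ?L t) ^ m * of_int (?L t)"
        by (simp add: \<eta>_def m power_mult_distrib power_mult power2_eq_square)
      then show ?thesis using Legendre_square[OF p_odd_prime unit_not_dvd[OF that]] by simp
    qed
    \<comment> \<open>The residue 0 can be added without changing the sum.\<close>
    moreover have "?L 0 = 0" by (simp add: Legendre_def)
    ultimately have \<sigma>: "(\<Sum>t\<in>{1..<int p}. \<eta> t) = 0"
      using sum_Legendre[OF p_odd_prime] unfolding units by simp
    have "of_real (P * N) = complex_of_real (P * P ^ (n - 1))"
      using card_isotropic by (simp add: \<sigma> P_def N_def card m)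
    then have N: "N = P ^ (n - 1)" using P0 by (simp only: of_real_eq_iff) simp
    have "of_real (d * (P\<^sup>2 - 1)) = complex_of_real (N - 1)"
      using dim_fixed_space by (simp add: inv d_def P_def N_def \<sigma>)
    then have "d * (P\<^sup>2 - 1) = N - 1" by (simp only: of_real_eq_iff)
    then show "real (vec.dim (invariants \<rho>)) = (real p ^ (n - 1) - 1) / (real p ^ 2 - 1)"
      using P0 by (simp add: N field_simps flip: d_def P_def)
  next
    assume "even n"
    then obtain m where m: "n = 2 * m" by (rule evenE)
    \<comment> \<open>The sign in \<open>G = \<kappa> * P ^ m\<close>: \<open>g ^ n\<close> is the
      power \<open>m\<close> of \<open>g * g = ?L (-1) * p\<close>.\<close>
    define \<kappa> where "\<kappa> = real_of_int (A * ?L (-1) ^ m)"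
    define x where "x = P ^ m"
    have x: "x \<noteq> 0" using P0 by (simp add: x_def)
    have "\<eta> t = 1" if "t \<in> {1..<int p}" for t
    proof -
      have "\<eta> t = of_int (?L t * ?L t) ^ m"
        by (simp add: \<eta>_def m power_mult power2_eq_square)
      then show ?thesis using Legendre_square[OF p_odd_prime unit_not_dvd[OF that]] by simp
    qed
    then have \<sigma>: "(\<Sum>t\<in>{1..<int p}. \<eta> t) = of_real (P - 1)"
      using p2 by (simp add: P_def of_nat_diff)
    have "?L (-1) * ?L (-1) = 1"
      using p2 by (intro Legendre_square[OF p_odd_prime]) simp
    then have "(A * ?L (-1) ^ m) * (A * ?L (-1) ^ m) = 1"
      using AA by (metis (no_types, lifting) mult.assoc mult.left_commute mult_1 power_mult_distrib power_one)
    then have \<kappa>2: "\<kappa> * \<kappa> = 1" unfolding \<kappa>_def by (metis of_int_1 of_int_mult)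
    have "g ^ n = (g * g) ^ m" by (simp add: m power_mult power2_eq_square)
    then have G': "G = of_real (\<kappa> * x)"
      by (simp add: G g2 \<kappa>_def x_def P_def power_mult_distrib)
    have card': "of_nat CARD('d) = complex_of_real (x * x)"
      by (simp add: card m x_def P_def power_mult power2_eq_square power_mult_distrib)
    have "of_real (P * N) = complex_of_real (x * x + \<kappa> * x * (P - 1))"
      using card_isotropic by (simp only: \<sigma> G' card') (simp add: P_def N_def)
    then have N: "N = (x * x + \<kappa> * x * (P - 1)) / P"
      using P0 by (simp only: of_real_eq_iff) (simp add: field_simps)
    have "of_real (d * (P\<^sup>2 - 1)) =
        complex_of_real (P * (\<kappa> * x / (x * x) * N * (P - 1)) + N + (P - 1) - 1)"
      using dim_fixed_space[folded inv] by (simp only: \<sigma> G' card') (simp add: d_def P_def N_def)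
    then have "d * (P\<^sup>2 - 1) = P * (\<kappa> * x / (x * x) * N * (P - 1)) + N + (P - 1) - 1"
      by (simp only: of_real_eq_iff)
    also have "P * (\<kappa> * x / (x * x) * N * (P - 1)) = \<kappa> * x * (P - 1) + \<kappa> * \<kappa> * (P - 1) * (P - 1)"
      unfolding N using x P0 by (simp add: field_simps)
    \<comment> \<open>Rewriting through \<open>x / P\<close> collects the coefficient
      \<open>P * (P - 1) + (P - 1) = P\<^sup>2 - 1\<close>.\<close>
    also have "\<kappa> * x * (P - 1) = \<kappa> * (x / P) * P * (P - 1)" using P0 by simp
    also have "N = x * x / P + \<kappa> * (x / P) * (P - 1)" by (simp add: N add_divide_distrib)
    also have "\<kappa> * y * P * (P - 1) + \<kappa> * \<kappa> * (P - 1) * (P - 1) + (z + \<kappa> * y * (P - 1)) + (P - 1) - 1 =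
        (z - P) + \<kappa> * y * (P\<^sup>2 - 1) + (P\<^sup>2 - 1)" for y z
      unfolding \<kappa>2 by (simp add: algebra_simps power2_eq_square)
    finally have "d * (P\<^sup>2 - 1) = (x * x / P - P) + \<kappa> * (x / P) * (P\<^sup>2 - 1) + (P\<^sup>2 - 1)" .
    then have "d = ((x * x / P - P) + \<kappa> * (x / P) * (P\<^sup>2 - 1) + (P\<^sup>2 - 1)) / (P\<^sup>2 - 1)"
      using P0(2) by (metis nonzero_mult_div_cancel_right)
    then have d: "d = (x * x / P - P) / (P\<^sup>2 - 1) + \<kappa> * (x / P) + 1"
      using P0(2) by (simp add: add_divide_distrib)
    \<comment> \<open>Integer powers cover \<open>n = 0\<close>, where both exponents in the formula
      are -1.\<close>
    have "P powi int n = x * x"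
      by (simp only: power_int_of_nat) (simp add: m x_def mult_2 power_add)
    then have pow1: "P powi (int n - 1) = x * x / P"
      using P0 by (simp add: power_int_diff)
    have "(int n - 2) div 2 = int m - 1" by (simp add: m)
    then have pow2: "P powi ((int n - 2) div 2) = x / P"
      using P0 by (simp add: power_int_diff x_def)
    \<comment> \<open>For even \<open>n\<close> the factors \<open>?L 2\<close> cancel in pairs, so
      \<open>\<epsilon> = A\<close>.\<close>
    have "\<epsilon> = (\<Prod>i<n. ?L 2 * ?L (a i))" by (simp add: \<epsilon> Legendre_mult[OF p_odd_prime])
    also have "\<dots> = (?L 2 * ?L 2) ^ m * A"
      by (simp add: prod.distrib A_def m power_mult power2_eq_square)
    also have "?L 2 * ?L 2 = 1"
      using p2 by (intro Legendre_square[OF p_odd_prime]) (auto dest: zdvd_imp_le)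
    finally have "of_int \<epsilon> * of_int (?L (-1)) ^ (n div 2) = \<kappa>" by (simp add: \<kappa>_def m)
    then show "real (vec.dim (invariants \<rho>)) =
        (real p powi (int n - 1) - real p) / (real p ^ 2 - 1)
        + of_int \<epsilon> * of_int (Legendre (-1) (int p)) ^ (n div 2)
          * real p powi ((int n - 2) div 2)
        + 1"
      using d by (simp only: pow1 pow2 flip: d_def P_def)
  qed
qed

end
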